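(* Let $n\ge2$, let $\beta$ be a $W(B_n)$-orbit in $(S_{\boldsymbol{\lambda}})^n$, and let $m:S_{\boldsymbol{\lambda}}\to\mathbb{Z}_{\ge0}$ be a map with only finitely many non-zero values. Assume that $m(i^{-1})=m(i)$ for all $i\in S_{\boldsymbol{\lambda}}$. Then the algebra $W^\beta_{\boldsymbol{\lambda},m}$ is isomorphic to the fixed point subalgebra $\bigl(V^\beta_{\boldsymbol{\lambda},m}\bigr)^{\tilde\rho}=\{x\in V^\beta_{\boldsymbol{\lambda},m}\mid\tilde\rho(x)=x\}$, where $\tilde\rho$ is the involutive automorphism of $V^\beta_{\boldsymbol{\lambda},m}$ given on generators by $\psi_0\mapsto-\psi_0$, $\psi_b\mapsto\psi_b$ for $1\le b\le n-1$, $y_j\mapsto y_j$ for $1\le j\le n$, and $e(\mathbf{i})\mapsto e(\mathbf{i})$ for $\mathbf{i}\in\beta$.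
   Context: **Ground data.** $K$ is a field of characteristic different from $2$, and $q\in K\setminus\{0\}$ with $q^2\neq 1$. For $\lambda\in K\setminus\{0\}$ put $I_\lambda:=\{\lambda^{\epsilon}q^{2t}\mid \epsilon\in\{-1,1\},\ t\in\mathbb{Z}\}$. Fix a tuple $\boldsymbol{\lambda}=(\lambda_1,\dots,\lambda_l)$ of elements of $K\setminus\{0\}$ with $I_{\lambda_a}\cap I_{\lambda_b}=\emptyset$ for $a\neq b$, and put $S_{\boldsymbol{\lambda}}:=I_{\lambda_1}\cup\dots\cup I_{\lambda_l}$. For $i,j\in S_{\boldsymbol{\lambda}}$ write: $i\nleftrightarrow j$ if $i\neq j$ and $j\notin\{q^2i,q^{-2}i\}$; $i\rightarrow j$ if $j=q^2i\neq q^{-2}i$; $i\leftarrow j$ if $j=q^{-2}i\neq q^2i$; $i\leftrightarrow j$ if $j=q^2i=q^{-2}i$. **Actions.** The Weyl group $W(B_n)$ (Coxeter generators $r_0,\dots,r_{n-1}$, with $r_0r_1$ of order 4) acts on $(S_{\boldsymbol{\lambda}})^n$ by $r_0\cdot(i_1,\dots,i_n)=(i_1^{-1},i_2,\dots,i_n)$ and $r_k$ ($1\le k\le n-1$) exchanging the entries in positions $k,k+1$. The Weyl group $W(D_n)$ (Coxeter generators $s_0,\dots,s_{n-1}$, identified with a subgroup of $W(B_n)$ by $s_0=r_0r_1r_0$, $s_k=r_k$) acts by $s_0\cdot(i_1,\dots,i_n)=(i_2^{-1},i_1^{-1},i_3,\dots,i_n)$ and $s_k$ exchanging the entries in positions $k,k+1$.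 A $W(B_n)$-orbit $\beta$ is finite and stable under $W(D_n)$. **Algebra $V^\beta_{\boldsymbol{\lambda}}$.** It is the unital $K$-algebra generated by $\psi_0,\dots,\psi_{n-1}$, $y_1,\dots,y_n$ and $e(\mathbf{i})$, $\mathbf{i}\in\beta$, with the following relations, for all $\mathbf{i}=(i_1,\dots,i_n),\mathbf{j}\in\beta$, all $a\in\{0,\dots,n-1\}$, $b\in\{1,\dots,n-1\}$, $j,k\in\{1,\dots,n\}$ for which they make sense ($\pi_b$ is the transposition $(b,b+1)$): - $\sum_{\mathbf{i}\in\beta}e(\mathbf{i})=1$, $e(\mathbf{i})e(\mathbf{j})=\delta_{\mathbf{i},\mathbf{j}}e(\mathbf{i})$, $y_jy_k=y_ky_j$, $y_je(\mathbf{i})=e(\mathbf{i})y_j$, $\psi_ae(\mathbf{i})=e(r_a(\mathbf{i}))\psi_a$; - $(\psi_by_j-y_{\pi_b(j)}\psi_b)e(\mathbf{i})$ equals $-e(\mathbf{i})$ if $j=b$ and $i_b=i_{b+1}$; $e(\mathbf{i})$ if $j=b+1$ and $i_b=i_{b+1}$; $0$ otherwise; - $\psi_a\psi_b=\psi_b\psi_a$ if $|a-b|>1$; - $\psi_b^2e(\mathbf{i})$ equals $0$ if $i_b=i_{b+1}$; $e(\mathbf{i})$ if $i_b\nleftrightarrow i_{b+1}$; $(y_{b+1}-y_b)e(\mathbf{i})$ if $i_b\rightarrow i_{b+1}$; $(y_b-y_{b+1})e(\mathbf{i})$ if $i_b\leftarrow i_{b+1}$; $(y_{b+1}-y_b)(y_b-y_{b+1})e(\mathbf{i})$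 if $i_b\leftrightarrow i_{b+1}$; - $(\psi_b\psi_{b+1}\psi_b-\psi_{b+1}\psi_b\psi_{b+1})e(\mathbf{i})$ equals $e(\mathbf{i})$ if $i_b=i_{b+2}\rightarrow i_{b+1}$; $-e(\mathbf{i})$ if $i_b=i_{b+2}\leftarrow i_{b+1}$; $(y_{b+2}-2y_{b+1}+y_b)e(\mathbf{i})$ if $i_b=i_{b+2}\leftrightarrow i_{b+1}$; $0$ otherwise; - $\psi_0y_1+y_1\psi_0=0$; $\psi_0y_j=y_j\psi_0$ if $j>1$; $\psi_0^2=1$; $(\psi_0\psi_1)^2=(\psi_1\psi_0)^2$. **Algebra $W^\beta_{\boldsymbol{\lambda}}$.** It is the unital $K$-algebra generated by $\Psi_0,\dots,\Psi_{n-1}$, $y_1,\dots,y_n$ and $e(\mathbf{i})$, $\mathbf{i}\in\beta$, with the following relations (same index conventions, $b,b'\in\{1,\dots,n-1\}$): - the relations $\sum_{\mathbf{i}\in\beta}e(\mathbf{i})=1$, $e(\mathbf{i})e(\mathbf{j})=\delta_{\mathbf{i},\mathbf{j}}e(\mathbf{i})$, $y_jy_k=y_ky_j$, $y_je(\mathbf{i})=e(\mathbf{i})y_j$, $\Psi_ae(\mathbf{i})=e(s_a(\mathbf{i}))\Psi_a$ for $a\in\{0,\dots,n-1\}$; - for $b,b'\ge1$: $\Psi_b\Psi_{b'}=\Psi_{b'}\Psi_b$ if $|b-b'|>1$, and the relations displayed above for $(\psi_by_j-y_{\pi_b(j)}\psi_b)e(\mathbf{i})$, $\psi_b^2e(\mathbf{i})$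 and $(\psi_b\psi_{b+1}\psi_b-\psi_{b+1}\psi_b\psi_{b+1})e(\mathbf{i})$, with each $\psi$ replaced by $\Psi$; - $\Psi_0y_je(\mathbf{i})$ equals $(-y_{\pi_1(j)}\Psi_0+1)e(\mathbf{i})$ if $j\in\{1,2\}$ and $i_1^{-1}=i_2$; $-y_{\pi_1(j)}\Psi_0e(\mathbf{i})$ if $j\in\{1,2\}$ and $i_1^{-1}\neq i_2$; $y_j\Psi_0e(\mathbf{i})$ otherwise; - $\Psi_0\Psi_b=\Psi_b\Psi_0$ if $b=1$ or $b>2$; - $\Psi_0^2e(\mathbf{i})$ equals $0$ if $i_1^{-1}=i_2$; $e(\mathbf{i})$ if $i_1^{-1}\nleftrightarrow i_2$; $(y_1+y_2)e(\mathbf{i})$ if $i_1^{-1}\rightarrow i_2$; $-(y_1+y_2)e(\mathbf{i})$ if $i_1^{-1}\leftarrow i_2$; $-(y_1+y_2)^2e(\mathbf{i})$ if $i_1^{-1}\leftrightarrow i_2$; - $(\Psi_0\Psi_2\Psi_0-\Psi_2\Psi_0\Psi_2)e(\mathbf{i})$ equals $e(\mathbf{i})$ if $i_1^{-1}=i_3\rightarrow i_2$; $-e(\mathbf{i})$ if $i_1^{-1}=i_3\leftarrow i_2$; $(y_3-2y_2-y_1)e(\mathbf{i})$ if $i_1^{-1}=i_3\leftrightarrow i_2$; $0$ otherwise. **Cyclotomic quotients.** $V^\beta_{\boldsymbol{\lambda},m}$ (resp. $W^\beta_{\boldsymbol{\lambda},m}$) is the quotient of $V^\beta_{\boldsymbol{\lambda}}$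 (resp. $W^\beta_{\boldsymbol{\lambda}}$) by the relations $y_1^{m(i_1)}e(\mathbf{i})=0$ for all $\mathbf{i}=(i_1,\dots,i_n)\in\beta$ (with $y_1^0=1$). Generators keep the same names in the quotients. *)

theory Defs
  imports
    "HOL-Algebra.QuotRing"
    "HOL-Algebra.Module"
    "HOL-Library.Poly_Mapping"
    "HOL-Library.FuncSet"
    "HOL-Combinatorics.Transposition"
begin

section \<open>Associative algebras given by generators and relations\<close>

text \<open>
  Words over an alphabet form a monoid under concatenation, written additively because the
  convolution product of \<^typ>\<open>'a \<Rightarrow>\<^sub>0 'b\<close> is indexed by an additive monoid.
  Hence \<^typ>\<open>'a \<Rightarrow>\<^sub>0 'b\<close> with words as indices carries the multiplication of noncommutative polynomials.
\<close>

datatype 'g word = Word (letters: "'g list")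

instantiation word :: (type) monoid_add
begin

definition zero_word :: "'a word" where "zero_word = Word []"

definition plus_word :: "'a word \<Rightarrow> 'a word \<Rightarrow> 'a word"
  where "plus_word u v = Word (letters u @ letters v)"

instance by standard (simp_all add: zero_word_def plus_word_def)

end

type_synonym ('k, 'g) ncpoly = "'g word \<Rightarrow>\<^sub>0 'k"

definition var :: "'g \<Rightarrow> ('k::comm_ring_1, 'g) ncpoly"
  where "var g = Poly_Mapping.single (Word [g]) 1"

text \<open>
  An algebra over a type-class field \<^typ>\<open>'k\<close> is represented by the record
  \<^type>\<open>module\<close>, i.e. a ring record together with a scalar multiplication.  (The locale
  \<^locale>\<open>algebra\<close> of the library is about commutative algebras only.)
\<close>

definition free_algebra :: "'g set \<Rightarrow> ('k::comm_ring_1, ('k, 'g) ncpoly) module"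
  where "free_algebra G =
    \<lparr>carrier = {p. \<forall>w \<in> Poly_Mapping.keys p. set (letters w) \<subseteq> G},
     mult = (*), one = 1, zero = 0, add = (+),
     smult = (\<lambda>c. Poly_Mapping.map ((*) c))\<rparr>"

definition quotient_algebra ::
    "('k, 'a, 'c) module_scheme \<Rightarrow> 'a set \<Rightarrow> ('k, 'a set) module"
  where "quotient_algebra A I =
    ring.extend (A Quot I) (module.fields (\<lambda>c X. \<Union>x\<in>X. I +>\<^bsub>A\<^esub> (c \<odot>\<^bsub>A\<^esub> x)))"

text \<open>A pair \<open>(u, v)\<close> in \<open>R\<close> stands for the relation \<open>u = v\<close>.\<close>

definition relation_ideal ::
    "'g set \<Rightarrow> (('k::comm_ring_1, 'g) ncpoly \<times> ('k, 'g) ncpoly) set \<Rightarrow> ('k, 'g) ncpoly set"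
  where "relation_ideal G R = Idl\<^bsub>free_algebra G\<^esub> {u - v |u v. (u, v) \<in> R}"

definition presented_algebra ::
    "'g set \<Rightarrow> (('k::comm_ring_1, 'g) ncpoly \<times> ('k, 'g) ncpoly) set
      \<Rightarrow> ('k, ('k, 'g) ncpoly set) module"
  where "presented_algebra G R = quotient_algebra (free_algebra G) (relation_ideal G R)"

definition presented_gen ::
    "'g set \<Rightarrow> (('k::comm_ring_1, 'g) ncpoly \<times> ('k, 'g) ncpoly) set
      \<Rightarrow> 'g \<Rightarrow> ('k, 'g) ncpoly set"
  where "presented_gen G R g = relation_ideal G R +>\<^bsub>free_algebra G\<^esub> var g"

definition algebra_iso ::
    "('k, 'a, 'c) module_scheme \<Rightarrow> ('k, 'b, 'd) module_scheme \<Rightarrow> ('a \<Rightarrow> 'b) set"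
  where "algebra_iso A B =
    {h \<in> ring_iso A B. \<forall>c. \<forall>x \<in> carrier A. h (c \<odot>\<^bsub>A\<^esub> x) = c \<odot>\<^bsub>B\<^esub> h x}"

definition fixed_subalgebra ::
    "('k, 'a, 'c) module_scheme \<Rightarrow> ('a \<Rightarrow> 'a) \<Rightarrow> ('k, 'a, 'c) module_scheme"
  where "fixed_subalgebra A \<rho> = A\<lparr>carrier := {x \<in> carrier A. \<rho> x = x}\<rparr>"


section \<open>The vertex set and its arrows\<close>

definition I_set :: "'k::field \<Rightarrow> 'k \<Rightarrow> 'k set"
  where "I_set q l = {(l powi \<epsilon>) * (q powi (2 * t)) |\<epsilon> t. \<epsilon> \<in> {-1, 1}}"

definition S_set :: "'k::field \<Rightarrow> 'k list \<Rightarrow> 'k set"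
  where "S_set q ls = (\<Union>a<length ls. I_set q (ls ! a))"

definition no_arrow :: "'k::field \<Rightarrow> 'k \<Rightarrow> 'k \<Rightarrow> bool"
  where "no_arrow q i j \<longleftrightarrow> i \<noteq> j \<and> j \<notin> {q powi 2 * i, q powi (-2) * i}"

definition right_arrow :: "'k::field \<Rightarrow> 'k \<Rightarrow> 'k \<Rightarrow> bool"
  where "right_arrow q i j \<longleftrightarrow> j = q powi 2 * i \<and> q powi 2 * i \<noteq> q powi (-2) * i"

definition left_arrow :: "'k::field \<Rightarrow> 'k \<Rightarrow> 'k \<Rightarrow> bool"
  where "left_arrow q i j \<longleftrightarrow> j = q powi (-2) * i \<and> q powi (-2) * i \<noteq> q powi 2 * i"

definition double_arrow :: "'k::field \<Rightarrow> 'k \<Rightarrow> 'k \<Rightarrow> bool"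
  where "double_arrow q i j \<longleftrightarrow> j = q powi 2 * i \<and> q powi 2 * i = q powi (-2) * i"


section \<open>Actions of the Weyl groups on tuples\<close>

text \<open>A tuple \<open>(i_1, \<dots>, i_n)\<close> with entries in \<open>S\<close> is an element of
  \<^term>\<open>{1..n} \<rightarrow>\<^sub>E S\<close>.\<close>

type_synonym 'k tuple = "nat \<Rightarrow> 'k"

definition r_act :: "nat \<Rightarrow> 'k::field tuple \<Rightarrow> 'k tuple"
  where "r_act a i =
    (if a = 0 then i(1 := inverse (i 1)) else i(a := i (a + 1), a + 1 := i a))"

definition s_act :: "nat \<Rightarrow> 'k::field tuple \<Rightarrow> 'k tuple"
  where "s_act a i =
    (if a = 0 then i(1 := inverse (i 2), 2 := inverse (i 1))
     else i(a := i (a + 1), a + 1 := i a))"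

text \<open>The generators of \<open>W(B_n)\<close> are involutions, so every group element is
  a product \<open>r_{a_1} \<dots> r_{a_k}\<close> of generators.\<close>

definition WB_orbit :: "nat \<Rightarrow> 'k::field tuple \<Rightarrow> 'k tuple set"
  where "WB_orbit n i = {foldr r_act as i |as. set as \<subseteq> {0..<n}}"

definition WB_orbits :: "nat \<Rightarrow> 'k::field set \<Rightarrow> 'k tuple set set"
  where "WB_orbits n S = WB_orbit n ` ({1..n} \<rightarrow>\<^sub>E S)"


section \<open>The algebras \<open>V\<close> and \<open>W\<close> and their cyclotomic quotients\<close>

text \<open>The letters \<open>Psi a\<close> play the role of \<open>\<psi>\<^sub>a\<close> in \<open>V\<close>
  and of \<open>\<Psi>\<^sub>a\<close> in \<open>W\<close>.\<close>

datatype 'k gen = Psi nat | Y nat | E "'k tuple"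

type_synonym 'k gen_poly = "('k, 'k gen) ncpoly"

definition gens :: "nat \<Rightarrow> 'k tuple set \<Rightarrow> 'k gen set"
  where "gens n \<beta> = Psi ` {0..<n} \<union> Y ` {1..n} \<union> E ` \<beta>"

abbreviation \<psi> :: "nat \<Rightarrow> 'k::field gen_poly" where "\<psi> a \<equiv> var (Psi a)"
abbreviation \<yy> :: "nat \<Rightarrow> 'k::field gen_poly" where "\<yy> j \<equiv> var (Y j)"
abbreviation \<ee> :: "'k tuple \<Rightarrow> 'k::field gen_poly" where "\<ee> i \<equiv> var (E i)"

text \<open>The relations common to \<open>V\<close> and \<open>W\<close>, except for the one moving
  \<open>\<psi>\<^sub>a\<close> past \<open>\<ee> i\<close>, where the two actions differ.\<close>

inductive_set common_rel ::
    "'k::field \<Rightarrow> nat \<Rightarrow> 'k tuple set \<Rightarrow> ('k gen_poly \<times> 'k gen_poly) set"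
  for q :: "'k::field" and n :: nat and \<beta> :: "'k tuple set"
where
  e_sum: "(\<Sum>i\<in>\<beta>. \<ee> i, 1) \<in> common_rel q n \<beta>"
| e_e: "i \<in> \<beta> \<Longrightarrow> j \<in> \<beta> \<Longrightarrow> (\<ee> i * \<ee> j, if i = j then \<ee> i else 0) \<in> common_rel q n \<beta>"
| y_y: "j \<in> {1..n} \<Longrightarrow> k \<in> {1..n} \<Longrightarrow> (\<yy> j * \<yy> k, \<yy> k * \<yy> j) \<in> common_rel q n \<beta>"
| y_e: "i \<in> \<beta> \<Longrightarrow> j \<in> {1..n} \<Longrightarrow> (\<yy> j * \<ee> i, \<ee> i * \<yy> j) \<in> common_rel q n \<beta>"
| psi_y: "i \<in> \<beta> \<Longrightarrow> b \<in> {1..n-1} \<Longrightarrow> j \<in> {1..n} \<Longrightarrow>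
    ((\<psi> b * \<yy> j - \<yy> (Transposition.transpose b (b+1) j) * \<psi> b) * \<ee> i,
     if j = b \<and> i b = i (b+1) then - \<ee> i
     else if j = b+1 \<and> i b = i (b+1) then \<ee> i
     else 0) \<in> common_rel q n \<beta>"
| psi_comm: "b \<in> {1..n-1} \<Longrightarrow> c \<in> {1..n-1} \<Longrightarrow> \<bar>int b - int c\<bar> > 1 \<Longrightarrow>
    (\<psi> b * \<psi> c, \<psi> c * \<psi> b) \<in> common_rel q n \<beta>"
| psi_sq_eq: "i \<in> \<beta> \<Longrightarrow> b \<in> {1..n-1} \<Longrightarrow> i b = i (b+1) \<Longrightarrow>
    (\<psi> b ^ 2 * \<ee> i, 0) \<in> common_rel q n \<beta>"
| psi_sq_none: "i \<in> \<beta> \<Longrightarrow> b \<in> {1..n-1} \<Longrightarrow> no_arrow q (i b) (i (b+1)) \<Longrightarrow>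
    (\<psi> b ^ 2 * \<ee> i, \<ee> i) \<in> common_rel q n \<beta>"
| psi_sq_right: "i \<in> \<beta> \<Longrightarrow> b \<in> {1..n-1} \<Longrightarrow> right_arrow q (i b) (i (b+1)) \<Longrightarrow>
    (\<psi> b ^ 2 * \<ee> i, (\<yy> (b+1) - \<yy> b) * \<ee> i) \<in> common_rel q n \<beta>"
| psi_sq_left: "i \<in> \<beta> \<Longrightarrow> b \<in> {1..n-1} \<Longrightarrow> left_arrow q (i b) (i (b+1)) \<Longrightarrow>
    (\<psi> b ^ 2 * \<ee> i, (\<yy> b - \<yy> (b+1)) * \<ee> i) \<in> common_rel q n \<beta>"
| psi_sq_double: "i \<in> \<beta> \<Longrightarrow> b \<in> {1..n-1} \<Longrightarrow> double_arrow q (i b) (i (b+1)) \<Longrightarrow>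
    (\<psi> b ^ 2 * \<ee> i, (\<yy> (b+1) - \<yy> b) * (\<yy> b - \<yy> (b+1)) * \<ee> i) \<in> common_rel q n \<beta>"
| psi_braid: "i \<in> \<beta> \<Longrightarrow> b \<in> {1..n-1} \<Longrightarrow> b + 1 \<in> {1..n-1} \<Longrightarrow>
    ((\<psi> b * \<psi> (b+1) * \<psi> b - \<psi> (b+1) * \<psi> b * \<psi> (b+1)) * \<ee> i,
     if i b = i (b+2) \<and> right_arrow q (i b) (i (b+1)) then \<ee> i
     else if i b = i (b+2) \<and> left_arrow q (i b) (i (b+1)) then - \<ee> i
     else if i b = i (b+2) \<and> double_arrow q (i b) (i (b+1))
       then (\<yy> (b+2) - 2 * \<yy> (b+1) + \<yy> b) * \<ee> i
     else 0) \<in> common_rel q n \<beta>"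

inductive_set V_rel ::
    "'k::field \<Rightarrow> nat \<Rightarrow> 'k tuple set \<Rightarrow> ('k gen_poly \<times> 'k gen_poly) set"
  for q :: "'k::field" and n :: nat and \<beta> :: "'k tuple set"
where
  common: "uv \<in> common_rel q n \<beta> \<Longrightarrow> uv \<in> V_rel q n \<beta>"
| psi_e: "i \<in> \<beta> \<Longrightarrow> a \<in> {0..n-1} \<Longrightarrow> (\<psi> a * \<ee> i, \<ee> (r_act a i) * \<psi> a) \<in> V_rel q n \<beta>"
| psi0_psi: "b \<in> {1..n-1} \<Longrightarrow> b > 1 \<Longrightarrow> (\<psi> 0 * \<psi> b, \<psi> b * \<psi> 0) \<in> V_rel q n \<beta>"
| psi0_y1: "(\<psi> 0 * \<yy> 1 + \<yy> 1 * \<psi> 0, 0) \<in> V_rel q n \<beta>"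
| psi0_y: "j \<in> {1..n} \<Longrightarrow> j > 1 \<Longrightarrow> (\<psi> 0 * \<yy> j, \<yy> j * \<psi> 0) \<in> V_rel q n \<beta>"
| psi0_sq: "(\<psi> 0 ^ 2, 1) \<in> V_rel q n \<beta>"
| psi0_braid: "((\<psi> 0 * \<psi> 1) ^ 2, (\<psi> 1 * \<psi> 0) ^ 2) \<in> V_rel q n \<beta>"

inductive_set W_rel ::
    "'k::field \<Rightarrow> nat \<Rightarrow> 'k tuple set \<Rightarrow> ('k gen_poly \<times> 'k gen_poly) set"
  for q :: "'k::field" and n :: nat and \<beta> :: "'k tuple set"
where
  common: "uv \<in> common_rel q n \<beta> \<Longrightarrow> uv \<in> W_rel q n \<beta>"
| psi_e: "i \<in> \<beta> \<Longrightarrow> a \<in> {0..n-1} \<Longrightarrow> (\<psi> a * \<ee> i, \<ee> (s_act a i) * \<psi> a) \<in> W_rel q n \<beta>"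
| psi0_y: "i \<in> \<beta> \<Longrightarrow> j \<in> {1..n} \<Longrightarrow>
    (\<psi> 0 * \<yy> j * \<ee> i,
     if j \<in> {1, 2} \<and> inverse (i 1) = i 2
       then (- \<yy> (Transposition.transpose 1 2 j) * \<psi> 0 + 1) * \<ee> i
     else if j \<in> {1, 2} \<and> inverse (i 1) \<noteq> i 2
       then - \<yy> (Transposition.transpose 1 2 j) * \<psi> 0 * \<ee> i
     else \<yy> j * \<psi> 0 * \<ee> i) \<in> W_rel q n \<beta>"
| psi0_psi: "b \<in> {1..n-1} \<Longrightarrow> b = 1 \<or> b > 2 \<Longrightarrow> (\<psi> 0 * \<psi> b, \<psi> b * \<psi> 0) \<in> W_rel q n \<beta>"
| psi0_sq_eq: "i \<in> \<beta> \<Longrightarrow> inverse (i 1) = i 2 \<Longrightarrow> (\<psi> 0 ^ 2 * \<ee> i, 0) \<in> W_rel q n \<beta>"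
| psi0_sq_none: "i \<in> \<beta> \<Longrightarrow> no_arrow q (inverse (i 1)) (i 2) \<Longrightarrow>
    (\<psi> 0 ^ 2 * \<ee> i, \<ee> i) \<in> W_rel q n \<beta>"
| psi0_sq_right: "i \<in> \<beta> \<Longrightarrow> right_arrow q (inverse (i 1)) (i 2) \<Longrightarrow>
    (\<psi> 0 ^ 2 * \<ee> i, (\<yy> 1 + \<yy> 2) * \<ee> i) \<in> W_rel q n \<beta>"
| psi0_sq_left: "i \<in> \<beta> \<Longrightarrow> left_arrow q (inverse (i 1)) (i 2) \<Longrightarrow>
    (\<psi> 0 ^ 2 * \<ee> i, - (\<yy> 1 + \<yy> 2) * \<ee> i) \<in> W_rel q n \<beta>"
| psi0_sq_double: "i \<in> \<beta> \<Longrightarrow> double_arrow q (inverse (i 1)) (i 2) \<Longrightarrow>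
    (\<psi> 0 ^ 2 * \<ee> i, - ((\<yy> 1 + \<yy> 2) ^ 2) * \<ee> i) \<in> W_rel q n \<beta>"
| psi0_braid: "i \<in> \<beta> \<Longrightarrow> 2 \<in> {1..n-1} \<Longrightarrow>
    ((\<psi> 0 * \<psi> 2 * \<psi> 0 - \<psi> 2 * \<psi> 0 * \<psi> 2) * \<ee> i,
     if inverse (i 1) = i 3 \<and> right_arrow q (inverse (i 1)) (i 2) then \<ee> i
     else if inverse (i 1) = i 3 \<and> left_arrow q (inverse (i 1)) (i 2) then - \<ee> i
     else if inverse (i 1) = i 3 \<and> double_arrow q (inverse (i 1)) (i 2)
       then (\<yy> 3 - 2 * \<yy> 2 - \<yy> 1) * \<ee> i
     else 0) \<in> W_rel q n \<beta>"

definition cyclotomic_rel ::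
    "('k::field \<Rightarrow> nat) \<Rightarrow> 'k tuple set \<Rightarrow> ('k gen_poly \<times> 'k gen_poly) set"
  where "cyclotomic_rel m \<beta> = {(\<yy> 1 ^ m (i 1) * \<ee> i, 0) |i. i \<in> \<beta>}"

definition V_cyc ::
    "'k::field \<Rightarrow> nat \<Rightarrow> 'k tuple set \<Rightarrow> ('k \<Rightarrow> nat) \<Rightarrow> ('k, 'k gen_poly set) module"
  where "V_cyc q n \<beta> m = presented_algebra (gens n \<beta>) (V_rel q n \<beta> \<union> cyclotomic_rel m \<beta>)"

definition W_cyc ::
    "'k::field \<Rightarrow> nat \<Rightarrow> 'k tuple set \<Rightarrow> ('k \<Rightarrow> nat) \<Rightarrow> ('k, 'k gen_poly set) module"
  where "W_cyc q n \<beta> m = presented_algebra (gens n \<beta>) (W_rel q n \<beta> \<union> cyclotomic_rel m \<beta>)"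

definition V_cyc_gen ::
    "'k::field \<Rightarrow> nat \<Rightarrow> 'k tuple set \<Rightarrow> ('k \<Rightarrow> nat) \<Rightarrow> 'k gen \<Rightarrow> 'k gen_poly set"
  where "V_cyc_gen q n \<beta> m = presented_gen (gens n \<beta>) (V_rel q n \<beta> \<union> cyclotomic_rel m \<beta>)"

definition is_rho_tilde ::
    "'k::field \<Rightarrow> nat \<Rightarrow> 'k tuple set \<Rightarrow> ('k \<Rightarrow> nat)
      \<Rightarrow> ('k gen_poly set \<Rightarrow> 'k gen_poly set) \<Rightarrow> bool"
  where "is_rho_tilde q n \<beta> m \<rho> \<longleftrightarrow>
    \<rho> \<in> algebra_iso (V_cyc q n \<beta> m) (V_cyc q n \<beta> m) \<and>
    (\<forall>x \<in> carrier (V_cyc q n \<beta> m). \<rho> (\<rho> x) = x) \<and>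
    \<rho> (V_cyc_gen q n \<beta> m (Psi 0)) = \<ominus>\<^bsub>V_cyc q n \<beta> m\<^esub> V_cyc_gen q n \<beta> m (Psi 0) \<and>
    (\<forall>b \<in> {1..n-1}. \<rho> (V_cyc_gen q n \<beta> m (Psi b)) = V_cyc_gen q n \<beta> m (Psi b)) \<and>
    (\<forall>j \<in> {1..n}. \<rho> (V_cyc_gen q n \<beta> m (Y j)) = V_cyc_gen q n \<beta> m (Y j)) \<and>
    (\<forall>i \<in> \<beta>. \<rho> (V_cyc_gen q n \<beta> m (E i)) = V_cyc_gen q n \<beta> m (E i))"

end

theory Submission
  imports Defs
begin

text \<open>
  The theorem holds because \<open>V\<close> is a skew group ring of \<open>W\<close>. Conjugation by the involution
  \<open>\<psi>\<^sub>0\<close> of \<open>V\<close> exchanges \<open>\<psi>\<^sub>1\<close> with \<open>\<psi>\<^sub>0 \<psi>\<^sub>1 \<psi>\<^sub>0\<close>, negates \<open>y\<^sub>1\<close>, moves \<open>e(i)\<close> to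
  \<open>e(r\<^sub>0 i)\<close> and fixes the other generators. If \<open>\<Psi>\<^sub>0\<close> is read as \<open>\<psi>\<^sub>0 \<psi>\<^sub>1 \<psi>\<^sub>0\<close>, in accordance
  with \<open>s\<^sub>0 = r\<^sub>0 r\<^sub>1 r\<^sub>0\<close>, this is an involutive automorphism of \<open>W\<close>, the flip \<open>\<theta>\<close>, and \<open>V\<close> consists
  of the sums \<open>a + b g\<close> with \<open>a\<close>, \<open>b\<close> in \<open>W\<close>, where \<open>g = \<psi>\<^sub>0\<close> satisfies \<open>g\<^sup>2 = 1\<close> and
  \<open>g a = \<theta>(a) g\<close>. The automorphism of the theorem is \<open>a + b g \<mapsto> a - b g\<close>, and since \<open>2\<close> is
  invertible its fixed points are exactly the elements \<open>a\<close> of \<open>W\<close>.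

  The argument is carried out with representatives in the free algebra and the two ideals of
  relations \<open>I\<^sub>V\<close> and \<open>I\<^sub>W\<close>. Four substitutions are used: \<open>embed\<close> from \<open>W\<close> to \<open>V\<close>, \<open>sign_change\<close>
  for the automorphism of \<open>V\<close>, \<open>flip\<close> for \<open>\<theta>\<close>, and \<open>to_skew\<close> from \<open>V\<close> to the skew group ring.
  Forming the skew group ring already over the free algebra makes it a type, in which
  \<open>to_skew (embed x)\<close> equals \<open>x + 0 g\<close> on the nose.

  The presentations match for the following reason. Every relation of \<open>W\<close> that involves \<open>\<Psi>\<^sub>0\<close>
  is, up to sign, the flip of a relation that does not, except for \<open>\<Psi>\<^sub>0 \<Psi>\<^sub>1 = \<Psi>\<^sub>1 \<Psi>\<^sub>0\<close>
  (\<open>W_rel_cases\<close>), and conversely the flips of the relations without \<open>\<Psi>\<^sub>0\<close> hold in \<open>W\<close>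
  (\<open>flip_type_A\<close>); the cyclotomic relations are respected because \<open>m (i\<^sup>-\<^sup>1) = m i\<close>. In \<open>V\<close>, \<open>\<psi>\<^sub>0\<close>
  intertwines \<open>embed\<close> with \<open>embed\<close> after \<open>flip\<close> (\<open>psi0_embed\<close>), so relations flip there as well,
  and the exceptional relation becomes the braid relation of length four. Hence \<open>embed\<close> induces a
  map \<open>W \<rightarrow> V\<close>. It is injective because \<open>to_skew\<close> sends \<open>I\<^sub>V\<close> to pairs of elements of \<open>I\<^sub>W\<close>
  (\<open>embed_I_iff\<close>), and its image is the fixed subalgebra because every element of \<open>V\<close> has the form
  \<open>embed a + embed b \<psi>\<^sub>0\<close> modulo \<open>I\<^sub>V\<close> (\<open>embed_decomposition\<close>, \<open>sign_change_fixed\<close>).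
\<close>

section \<open>The free algebra\<close>

lemma letters_add [simp]: "letters (u + v) = letters u @ letters v"
  by (simp add: plus_word_def)

lemma letters_zero [simp]: "letters 0 = []"
  by (simp add: zero_word_def)

lemma ncpoly_additive_induct [case_names single zero add]:
  fixes p :: "('k::comm_ring_1, 'g) ncpoly"
  assumes single: "\<And>w k. w \<in> Poly_Mapping.keys p \<Longrightarrow> P (Poly_Mapping.single w k)"
    and zero: "P 0" and add: "\<And>x y. P x \<Longrightarrow> P y \<Longrightarrow> P (x + y)"
  shows "P p"
proof -
  have "P (\<Sum>w\<in>A. Poly_Mapping.single w (Poly_Mapping.lookup p w))" if "finite A" "A \<subseteq> Poly_Mapping.keys p" for A
    using that by induction (auto intro: zero add single)
  then have "P (\<Sum>w\<in>Poly_Mapping.keys p. Poly_Mapping.single w (Poly_Mapping.lookup p w))" by simp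
  also have "(\<Sum>w\<in>Poly_Mapping.keys p. Poly_Mapping.single w (Poly_Mapping.lookup p w)) = p"
    by (rule poly_mapping_eqI)
      (auto simp: lookup_sum lookup_single when_def sum.delta' in_keys_iff)
  finally show ?thesis .
qed

lemma const_central:
  fixes p :: "('k::comm_ring_1, 'g) ncpoly"
  shows "Poly_Mapping.single 0 k * p = p * Poly_Mapping.single 0 k"
  by (induction p rule: ncpoly_additive_induct) (simp_all add: mult_single algebra_simps)

lemma smult_conv_const_mult:
  fixes p :: "('k::comm_ring_1, 'g) ncpoly"
  shows "Poly_Mapping.map ((*) c) p = Poly_Mapping.single 0 c * p"
proof -
  have "Poly_Mapping.lookup (Poly_Mapping.single 0 c * p) v = c * Poly_Mapping.lookup p v" for v
    by (induction p rule: ncpoly_additive_induct)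
      (simp_all add: mult_single lookup_single when_def lookup_add distrib_left)
  then show ?thesis
    by (intro poly_mapping_eqI) (simp add: map.rep_eq when_def)
qed

lemma single_Word_Cons:
  "Poly_Mapping.single (Word (g # gs)) (k::'k::comm_ring_1) = var g * Poly_Mapping.single (Word gs) k"
  by (simp add: var_def mult_single plus_word_def)

abbreviation free_carrier :: "'g set \<Rightarrow> ('k::comm_ring_1, 'g) ncpoly set"
  where "free_carrier G \<equiv> carrier (free_algebra G)"

lemma free_carrier_iff:
  "p \<in> free_carrier G \<longleftrightarrow> (\<forall>w \<in> Poly_Mapping.keys p. set (letters w) \<subseteq> G)"
  by (simp add: free_algebra_def)

lemma free_carrier_const [simp, intro]: "Poly_Mapping.single 0 k \<in> free_carrier G"
  by (auto simp: free_carrier_iff)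

lemma free_carrier_zero [simp, intro]: "0 \<in> free_carrier G"
  by (auto simp: free_carrier_iff)

lemma free_carrier_one [simp, intro]: "1 \<in> free_carrier G"
  using free_carrier_const[of 1] by simp

lemma free_carrier_numeral [simp, intro]: "numeral k \<in> free_carrier G"
  using free_carrier_const[of "numeral k"] by simp

lemma free_carrier_var [simp, intro]: "g \<in> G \<Longrightarrow> var g \<in> free_carrier G"
  by (auto simp: free_carrier_iff var_def)

lemma free_carrier_add [intro]:
  "x \<in> free_carrier G \<Longrightarrow> y \<in> free_carrier G \<Longrightarrow> x + y \<in> free_carrier G"
  using keys_add[of x y] by (force simp: free_carrier_iff)

lemma free_carrier_mult [intro]:
  "x \<in> free_carrier G \<Longrightarrow> y \<in> free_carrier G \<Longrightarrow> x * y \<in> free_carrier G"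
  using keys_mult[of x y] by (force simp: free_carrier_iff)

lemma free_carrier_uminus [intro]: "x \<in> free_carrier G \<Longrightarrow> - x \<in> free_carrier G"
  by (simp add: free_carrier_iff)

lemma free_carrier_diff [intro]:
  "x \<in> free_carrier G \<Longrightarrow> y \<in> free_carrier G \<Longrightarrow> x - y \<in> free_carrier G"
  using free_carrier_add[of x G "- y"] free_carrier_uminus[of y G] by simp

lemma free_carrier_power [intro]: "x \<in> free_carrier G \<Longrightarrow> x ^ k \<in> free_carrier G"
  by (induction k) auto

lemma free_carrier_sum [intro]:
  "(\<And>a. a \<in> A \<Longrightarrow> f a \<in> free_carrier G) \<Longrightarrow> sum f A \<in> free_carrier G"
  by (induction A rule: infinite_finite_induct) auto

lemma free_carrier_mono: "p \<in> free_carrier G \<Longrightarrow> G \<subseteq> H \<Longrightarrow> p \<in> free_carrier H"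
  by (force simp: free_carrier_iff)

lemma free_carrier_UNIV [simp]: "x \<in> free_carrier UNIV"
  by (simp add: free_carrier_iff)

lemma free_carrier_induct [consumes 1, case_names const gen add]:
  fixes p :: "('k::comm_ring_1, 'g) ncpoly"
  assumes p: "p \<in> free_carrier G"
    and const: "\<And>k. P (Poly_Mapping.single 0 k)"
    and gen: "\<And>g x. g \<in> G \<Longrightarrow> x \<in> free_carrier G \<Longrightarrow> P x \<Longrightarrow> P (var g * x)"
    and add: "\<And>x y. x \<in> free_carrier G \<Longrightarrow> y \<in> free_carrier G \<Longrightarrow> P x \<Longrightarrow> P y \<Longrightarrow> P (x + y)"
  shows "P p"
proof -
  have word: "Poly_Mapping.single (Word gs) k \<in> free_carrier G \<and> P (Poly_Mapping.single (Word gs) k)"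
    if "set gs \<subseteq> G" for gs k
    using that
  proof (induction gs)
    case Nil
    then show ?case using const[of k] free_carrier_const[of k G] by (simp add: zero_word_def)
  next
    case (Cons g gs)
    then show ?case by (auto simp: single_Word_Cons intro: gen)
  qed
  have "p \<in> free_carrier G \<and> P p"
  proof (induction p rule: ncpoly_additive_induct)
    case (single w k)
    then show ?case using word[of "letters w" k] p by (auto simp: free_carrier_iff)
  next
    case zero
    then show ?case using const[of 0] by simp
  qed (use add in auto)
  then show ?thesis ..
qed

subsection \<open>Evaluation of noncommutative polynomials\<close>

text \<open>Scalars are left out of this notion because constants have different images in different
  targets: \<open>Poly_Mapping.single 0 k\<close> in a free algebra, but a pair in the skew group ring below.\<close>

locale ncpoly_hom =
  fixes h :: "('k::comm_ring_1, 'g) ncpoly \<Rightarrow> 'a::ring_1"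
  assumes hom_add: "h (x + y) = h x + h y"
    and hom_mult: "h (x * y) = h x * h y"
    and hom_one: "h 1 = 1"
begin

lemma hom_zero: "h 0 = 0"
  using hom_add[of 0 0] by simp

lemma hom_uminus: "h (- x) = - h x"
  using hom_add[of x "- x"] minus_unique[of "h x" "h (- x)"] by (simp add: hom_zero)

lemma hom_diff: "h (x - y) = h x - h y"
  using hom_add[of x "- y"] by (simp add: hom_uminus)

lemma hom_sum: "h (sum f A) = (\<Sum>a\<in>A. h (f a))"
  by (induction A rule: infinite_finite_induct) (simp_all add: hom_zero hom_add)

lemma hom_power: "h (x ^ k) = h x ^ k"
  by (induction k) (simp_all add: hom_one hom_mult)

lemma hom_numeral: "h (numeral k) = numeral k"
proof -
  have "h (of_nat j) = of_nat j" for j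
    by (induction j) (simp_all add: hom_zero hom_add hom_one)
  from this[of "numeral k"] show ?thesis by simp
qed

lemmas hom_simps = hom_add hom_mult hom_one hom_zero hom_uminus hom_diff hom_sum hom_power hom_numeral

end

lemma ncpoly_hom_agree:
  assumes "ncpoly_hom h" "ncpoly_hom h'" and x: "x \<in> free_carrier G"
    and const: "\<And>k. h (Poly_Mapping.single 0 k) = h' (Poly_Mapping.single 0 k)"
    and var: "\<And>g. g \<in> G \<Longrightarrow> h (var g) = h' (var g)"
  shows "h x = h' x"
  using x by (induction rule: free_carrier_induct)
    (simp_all add: const var ncpoly_hom.hom_add[OF assms(1)] ncpoly_hom.hom_add[OF assms(2)]
      ncpoly_hom.hom_mult[OF assms(1)] ncpoly_hom.hom_mult[OF assms(2)])

lemma ncpoly_hom_compose: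
  fixes h' :: "('k::comm_ring_1, 'g) ncpoly \<Rightarrow> ('k, 'g) ncpoly"
  shows "ncpoly_hom h \<Longrightarrow> ncpoly_hom h' \<Longrightarrow> ncpoly_hom (\<lambda>x. h (h' x))"
  by (simp add: ncpoly_hom_def)

lemma ncpoly_hom_id: "ncpoly_hom (\<lambda>x. x)"
  by (simp add: ncpoly_hom_def)

text \<open>The target is any ring with a central copy of the scalars, given by \<open>c\<close>. This covers
  substitutions into a free algebra as well as evaluation in the skew group ring below.\<close>

definition nc_eval :: "('k::comm_ring_1 \<Rightarrow> 'a::ring_1) \<Rightarrow> ('g \<Rightarrow> 'a) \<Rightarrow> ('k, 'g) ncpoly \<Rightarrow> 'a"
  where "nc_eval c f p =
    (\<Sum>w\<in>Poly_Mapping.keys p. c (Poly_Mapping.lookup p w) * prod_list (map f (letters w)))"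

locale central_scalars =
  fixes c :: "'k::comm_ring_1 \<Rightarrow> 'a::ring_1"
  assumes scalar_add: "c (x + y) = c x + c y"
    and scalar_mult: "c (x * y) = c x * c y"
    and scalar_one: "c 1 = 1"
    and scalar_central: "c x * a = a * c x"
begin

lemma scalar_zero: "c 0 = 0"
  using scalar_add[of 0 0] by simp

lemma nc_eval_single:
  "nc_eval c f (Poly_Mapping.single w k) = c k * prod_list (map f (letters w))"
  by (simp add: nc_eval_def scalar_zero)

lemma nc_eval_add: "nc_eval c f (p + p') = nc_eval c f p + nc_eval c f p'"
proof -
  let ?A = "Poly_Mapping.keys p \<union> Poly_Mapping.keys p'"
  have ext: "nc_eval c f x = (\<Sum>w\<in>?A. c (Poly_Mapping.lookup x w) * prod_list (map f (letters w)))"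
    if "Poly_Mapping.keys x \<subseteq> ?A" for x
    unfolding nc_eval_def
    by (rule sum.mono_neutral_left) (use that in \<open>auto simp: in_keys_iff scalar_zero\<close>)
  show ?thesis
    by (simp add: ext keys_add lookup_add scalar_add distrib_right sum.distrib)
qed

lemma nc_eval_hom: "ncpoly_hom (nc_eval c f)"
proof
  have zero: "nc_eval c f 0 = 0"
    by (simp add: nc_eval_def)
  have mult_monomials: "nc_eval c f (Poly_Mapping.single u j * Poly_Mapping.single v k) =
      nc_eval c f (Poly_Mapping.single u j) * nc_eval c f (Poly_Mapping.single v k)" for u v j k
  proof -
    have "c j * c k * (prod_list (map f (letters u)) * prod_list (map f (letters v))) =
       c j * (c k * prod_list (map f (letters u))) * prod_list (map f (letters v))"
      by (simp add: mult.assoc)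
    also have "\<dots> = c j * prod_list (map f (letters u)) * (c k * prod_list (map f (letters v)))"
      by (simp only: scalar_central[of k "prod_list (map f (letters u))"] mult.assoc)
    finally show ?thesis
      by (simp add: mult_single nc_eval_single scalar_mult)
  qed
  show "nc_eval c f (x + y) = nc_eval c f x + nc_eval c f y" for x y
    by (rule nc_eval_add)
  show "nc_eval c f (x * y) = nc_eval c f x * nc_eval c f y" for x y
  proof (induction x rule: ncpoly_additive_induct)
    case (single u j)
    show ?case
      by (induction y rule: ncpoly_additive_induct)
        (simp_all add: zero nc_eval_add mult_monomials distrib_left)
  qed (simp_all add: zero nc_eval_add distrib_right)
  show "nc_eval c f 1 = 1"
    using nc_eval_single[of f 0 1] by (simp add: scalar_one)
qed

lemma nc_eval_const: "nc_eval c f (Poly_Mapping.single 0 k) = c k"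
  by (simp add: nc_eval_single)

lemma nc_eval_var: "nc_eval c f (var g) = f g"
  by (simp add: var_def nc_eval_single scalar_one)

end

definition nc_subst ::
    "('g \<Rightarrow> ('k::comm_ring_1, 'h) ncpoly) \<Rightarrow> ('k, 'g) ncpoly \<Rightarrow> ('k, 'h) ncpoly"
  where "nc_subst = nc_eval (Poly_Mapping.single 0)"

lemma central_scalars_const: "central_scalars (Poly_Mapping.single 0 :: 'k::comm_ring_1 \<Rightarrow> ('k, 'g) ncpoly)"
  by standard (simp_all add: single_add mult_single const_central)

lemma nc_subst_hom: "ncpoly_hom (nc_subst f)"
  and nc_subst_const [simp]: "nc_subst f (Poly_Mapping.single 0 k) = Poly_Mapping.single 0 k"
  and nc_subst_var [simp]: "nc_subst f (var g) = f g"
  unfolding nc_subst_def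
  by (rule central_scalars.nc_eval_hom central_scalars.nc_eval_const
      central_scalars.nc_eval_var central_scalars_const)+

lemmas nc_subst_simps = ncpoly_hom.hom_simps[OF nc_subst_hom]

lemma nc_subst_carrier:
  assumes f: "\<And>g. g \<in> G \<Longrightarrow> f g \<in> free_carrier H" and x: "x \<in> free_carrier G"
  shows "nc_subst f x \<in> free_carrier H"
  using x by (induction rule: free_carrier_induct) (auto simp: nc_subst_simps f)

lemma nc_subst_fix:
  assumes "\<And>g. g \<in> G \<Longrightarrow> f g = var g" and "x \<in> free_carrier G"
  shows "nc_subst f x = x"
  using ncpoly_hom_agree[OF nc_subst_hom ncpoly_hom_id assms(2), of f] assms(1) by simp

section \<open>Presented algebras and the maps between them\<close>

lemma free_algebra_simps [simp]:
  "x \<oplus>\<^bsub>free_algebra G\<^esub> y = x + y" "x \<otimes>\<^bsub>free_algebra G\<^esub> y = x * y"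
  "\<zero>\<^bsub>free_algebra G\<^esub> = 0" "\<one>\<^bsub>free_algebra G\<^esub> = 1"
  "c \<odot>\<^bsub>free_algebra G\<^esub> x = Poly_Mapping.single 0 c * x"
  by (simp_all add: free_algebra_def smult_conv_const_mult)

lemma free_algebra_ring: "ring (free_algebra G)"
proof (rule ringI)
  show "abelian_group (free_algebra G)"
  proof (rule abelian_groupI)
    show "\<exists>y\<in>free_carrier G. y \<oplus>\<^bsub>free_algebra G\<^esub> x = \<zero>\<^bsub>free_algebra G\<^esub>"
      if "x \<in> free_carrier G" for x
      using that by (intro bexI[of _ "- x"] free_carrier_uminus) simp_all
  qed (auto simp: algebra_simps)
  show "Group.monoid (free_algebra G)"
    by (rule monoidI) (auto simp: algebra_simps)
qed (auto simp: algebra_simps)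

lemma free_algebra_uminus: "x \<in> free_carrier G \<Longrightarrow> \<ominus>\<^bsub>free_algebra G\<^esub> x = - x"
proof -
  interpret ring "free_algebra G" by (rule free_algebra_ring)
  assume "x \<in> free_carrier G"
  then show ?thesis
    using free_carrier_uminus[of x G] by (intro minus_equality) simp_all
qed

locale presentation =
  fixes G :: "'g set" and R :: "(('k::comm_ring_1, 'g) ncpoly \<times> ('k, 'g) ncpoly) set"
  assumes rel_carrier: "(u, v) \<in> R \<Longrightarrow> u - v \<in> free_carrier G"
begin

abbreviation "I \<equiv> relation_ideal G R"
abbreviation "A \<equiv> presented_algebra G R"

definition cls :: "('k, 'g) ncpoly \<Rightarrow> ('k, 'g) ncpoly set"
  where "cls x = I +>\<^bsub>free_algebra G\<^esub> x"

lemma ideal_I: "ideal I (free_algebra G)"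
  unfolding relation_ideal_def
  by (rule ring.genideal_ideal[OF free_algebra_ring]) (auto intro: rel_carrier)

lemma I_carrier: "x \<in> I \<Longrightarrow> x \<in> free_carrier G"
  using ideal.Icarr[OF ideal_I] by blast

lemma I_zero [simp, intro]: "0 \<in> I"
  using additive_subgroup.zero_closed[OF ideal.axioms(1)[OF ideal_I]] by simp

lemma I_add [intro]: "x \<in> I \<Longrightarrow> y \<in> I \<Longrightarrow> x + y \<in> I"
  using additive_subgroup.a_closed[OF ideal.axioms(1)[OF ideal_I]] by simp

lemma I_uminus [intro]: "x \<in> I \<Longrightarrow> - x \<in> I"
  using additive_subgroup.a_inv_closed[OF ideal.axioms(1)[OF ideal_I], of x]
  by (simp add: free_algebra_uminus I_carrier)

lemma I_diff [intro]: "x \<in> I \<Longrightarrow> y \<in> I \<Longrightarrow> x - y \<in> I"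
  using I_add[of x "- y"] by auto

lemma I_mult_left: "x \<in> I \<Longrightarrow> a \<in> free_carrier G \<Longrightarrow> a * x \<in> I"
  using ideal.I_l_closed[OF ideal_I, of x a] by simp

lemma I_mult_right: "x \<in> I \<Longrightarrow> a \<in> free_carrier G \<Longrightarrow> x * a \<in> I"
  using ideal.I_r_closed[OF ideal_I, of x a] by simp

lemma I_rel: "(u, v) \<in> R \<Longrightarrow> u - v \<in> I"
  using ring.genideal_self[OF free_algebra_ring, of "{u - v |u v. (u, v) \<in> R}" G] rel_carrier
  unfolding relation_ideal_def by blast

lemma I_rel': "(u, v) \<in> R \<Longrightarrow> v - u \<in> I"
  using I_uminus[OF I_rel] by simp

text \<open>The preimage of \<open>J\<close> is an ideal of the free algebra that contains the relations. Closure of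
  \<open>J\<close> under multiplication is required only for factors in the image of the carrier, because the
  sets \<open>J\<close> of interest are ideals over a proper subset of the letters that the type provides.\<close>

lemma hom_image_I:
  fixes h :: "('k, 'g) ncpoly \<Rightarrow> 'a::ring_1"
  assumes h: "ncpoly_hom h" and x: "x \<in> I"
    and rel: "\<And>u v. (u, v) \<in> R \<Longrightarrow> h (u - v) \<in> J"
    and J: "0 \<in> J" "\<And>a b. a \<in> J \<Longrightarrow> b \<in> J \<Longrightarrow> a + b \<in> J" "\<And>a. a \<in> J \<Longrightarrow> - a \<in> J"
      "\<And>a y. a \<in> J \<Longrightarrow> y \<in> free_carrier G \<Longrightarrow> h y * a \<in> J"
      "\<And>a y. a \<in> J \<Longrightarrow> y \<in> free_carrier G \<Longrightarrow> a * h y \<in> J"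
  shows "h x \<in> J"
proof -
  interpret ncpoly_hom h by (rule h)
  interpret ring "free_algebra G" by (rule free_algebra_ring)
  let ?K = "{y \<in> free_carrier G. h y \<in> J}"
  have "ideal ?K (free_algebra G)"
  proof (rule idealI[OF free_algebra_ring])
    show "subgroup ?K (add_monoid (free_algebra G))"
    proof (rule group.subgroupI)
      show "Group.group (add_monoid (free_algebra G))"
        by (rule a_group)
      show "inv\<^bsub>add_monoid (free_algebra G)\<^esub> a \<in> ?K" if "a \<in> ?K" for a
        using that free_algebra_uminus[of a G] J(3)[of "h a"]
        unfolding a_inv_def[symmetric] by (auto simp: hom_uminus)
    qed (use J(1,2) hom_zero in \<open>auto simp: hom_add\<close>)
  qed (use J(4,5) in \<open>auto simp: hom_mult\<close>)
  then have "I \<subseteq> ?K"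
    unfolding relation_ideal_def
    by (rule genideal_minimal) (auto intro: rel_carrier rel)
  then show ?thesis using x by blast
qed

lemma carrier_A: "carrier A = cls ` free_carrier G"
  by (auto simp: presented_algebra_def quotient_algebra_def ring.defs FactRing_def A_RCOSETS_def'
      cls_def ring.extend_def)

lemma cls_carrier [intro]: "x \<in> free_carrier G \<Longrightarrow> cls x \<in> carrier A"
  by (auto simp: carrier_A)

lemma cls_conv: "cls x = {a + x |a. a \<in> I}"
  by (auto simp: cls_def a_r_coset_def')

lemma cls_eq_iff: "cls x = cls y \<longleftrightarrow> x - y \<in> I"
proof
  assume "cls x = cls y"
  moreover have "x \<in> cls x" using I_zero by (force simp: cls_conv)
  ultimately obtain a where "a \<in> I" "x = a + y" by (auto simp: cls_conv)
  then show "x - y \<in> I" by simp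
next
  assume xy: "x - y \<in> I"
  have "a + x \<in> cls y" "a + y \<in> cls x" if "a \<in> I" for a
  proof -
    show "a + x \<in> cls y"
      using I_add[OF that xy] unfolding cls_conv by (intro CollectI exI[of _ "a + (x - y)"]) auto
    show "a + y \<in> cls x"
      using I_diff[OF that xy] unfolding cls_conv by (intro CollectI exI[of _ "a - (x - y)"]) auto
  qed
  then show "cls x = cls y" by (auto simp: cls_conv[of x] cls_conv[of y])
qed

lemma A_mult: "x \<in> free_carrier G \<Longrightarrow> y \<in> free_carrier G \<Longrightarrow> cls x \<otimes>\<^bsub>A\<^esub> cls y = cls (x * y)"
  using ideal.rcoset_mult_add[OF ideal_I, of x y]
  by (simp add: presented_algebra_def quotient_algebra_def ring.defs FactRing_def cls_def)

lemma A_add: "x \<in> free_carrier G \<Longrightarrow> y \<in> free_carrier G \<Longrightarrow> cls x \<oplus>\<^bsub>A\<^esub> cls y = cls (x + y)"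
proof -
  interpret ideal I "free_algebra G" by (rule ideal_I)
  show "cls x \<oplus>\<^bsub>A\<^esub> cls y = cls (x + y)" if "x \<in> free_carrier G" "y \<in> free_carrier G"
    using a_rcos_sum[OF that]
    by (simp add: presented_algebra_def quotient_algebra_def ring.defs FactRing_def cls_def)
qed

lemma A_one: "\<one>\<^bsub>A\<^esub> = cls 1"
  by (simp add: presented_algebra_def quotient_algebra_def ring.defs FactRing_def cls_def)

lemma A_zero: "\<zero>\<^bsub>A\<^esub> = cls 0"
  by (simp add: presented_algebra_def quotient_algebra_def ring.defs FactRing_def cls_conv)

lemma A_smult: "x \<in> free_carrier G \<Longrightarrow> c \<odot>\<^bsub>A\<^esub> cls x = cls (Poly_Mapping.single 0 c * x)"
proof -
  assume x: "x \<in> free_carrier G"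
  have eq: "cls (Poly_Mapping.single 0 c * (a + x)) = cls (Poly_Mapping.single 0 c * x)" if "a \<in> I" for a
    using I_mult_left[OF that free_carrier_const[of c]] by (simp add: cls_eq_iff algebra_simps)
  have "c \<odot>\<^bsub>A\<^esub> cls x = (\<Union>y\<in>cls x. cls (Poly_Mapping.single 0 c * y))"
    by (simp add: presented_algebra_def quotient_algebra_def ring.defs cls_def module.defs)
  also have "\<dots> = (\<Union>a\<in>I. cls (Poly_Mapping.single 0 c * (a + x)))"
    by (auto simp: cls_conv[of x])
  also have "\<dots> = cls (Poly_Mapping.single 0 c * x)"
    using eq I_zero by auto
  finally show ?thesis .
qed

lemma A_uminus: "x \<in> free_carrier G \<Longrightarrow> \<ominus>\<^bsub>A\<^esub> cls x = cls (- x)"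
proof -
  assume x: "x \<in> free_carrier G"
  have "y = cls (- x)" if y: "y \<in> carrier A" and xy: "cls x \<oplus>\<^bsub>A\<^esub> y = \<zero>\<^bsub>A\<^esub>" for y
  proof -
    obtain z where z: "z \<in> free_carrier G" "y = cls z"
      using y by (auto simp: carrier_A)
    then have "x + z \<in> I"
      using xy x by (simp add: A_add A_zero cls_eq_iff)
    then show ?thesis
      by (simp add: z cls_eq_iff add.commute)
  qed
  then show ?thesis
    unfolding a_inv_def m_inv_def using x
    by (intro the_equality) (auto simp: A_add A_zero free_carrier_uminus cls_carrier)
qed

lemma presented_gen_eq_cls: "presented_gen G R g = cls (var g)"
  by (simp add: presented_gen_def cls_def)

end


text \<open>A substitution that respects carriers and ideals descends to cosets. The induced map picks a
  representative, which is harmless because the image of the ideal lies in the ideal.\<close>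

locale presentation_hom = P: presentation G R + Q: presentation H S
  for G :: "'g set" and R :: "(('k::comm_ring_1, 'g) ncpoly \<times> ('k, 'g) ncpoly) set"
    and H :: "'g set" and S :: "(('k, 'g) ncpoly \<times> ('k, 'g) ncpoly) set" +
  fixes h :: "('k, 'g) ncpoly \<Rightarrow> ('k, 'g) ncpoly"
  assumes hom: "ncpoly_hom h"
    and const: "h (Poly_Mapping.single 0 k) = Poly_Mapping.single 0 k"
    and carrier: "x \<in> free_carrier G \<Longrightarrow> h x \<in> free_carrier H"
    and ideal: "x \<in> P.I \<Longrightarrow> h x \<in> Q.I"
begin

sublocale ncpoly_hom h by (rule hom)

definition induced :: "('k, 'g) ncpoly set \<Rightarrow> ('k, 'g) ncpoly set"
  where "induced X = Q.cls (h (SOME x. x \<in> X))"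

lemma induced_cls: "induced (P.cls x) = Q.cls (h x)"
proof -
  have "x \<in> P.cls x"
    using P.I_zero by (force simp: P.cls_conv)
  then have "(SOME y. y \<in> P.cls x) \<in> P.cls x"
    by (rule someI)
  then have "(SOME y. y \<in> P.cls x) - x \<in> P.I"
    by (auto simp: P.cls_conv)
  from ideal[OF this] show ?thesis
    by (simp add: induced_def Q.cls_eq_iff hom_diff)
qed

lemma induced_ring_hom: "induced \<in> ring_hom P.A Q.A"
  by (rule ring_hom_memI)
    (auto simp: P.carrier_A P.A_mult P.A_add P.A_one Q.A_one Q.A_mult Q.A_add induced_cls hom_simps
      carrier free_carrier_mult free_carrier_add Q.cls_carrier)

lemma induced_smult:
  "X \<in> carrier P.A \<Longrightarrow> induced (c \<odot>\<^bsub>P.A\<^esub> X) = c \<odot>\<^bsub>Q.A\<^esub> induced X"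
  by (auto simp: P.carrier_A P.A_smult Q.A_smult induced_cls hom_simps const carrier)

end

section \<open>The flip and its skew group ring\<close>

text \<open>Conjugation by \<open>\<psi>\<^sub>0\<close> in \<open>V\<close>, written with the letter \<open>Psi 0\<close> for \<open>\<psi>\<^sub>0 \<psi>\<^sub>1 \<psi>\<^sub>0\<close> as in \<open>W\<close>.\<close>

definition flip_gen :: "'k::field gen \<Rightarrow> 'k gen_poly"
  where "flip_gen g = (case g of
      Psi a \<Rightarrow> var (Psi (Transposition.transpose 0 1 a))
    | Y j \<Rightarrow> if j = 1 then - var (Y j) else var (Y j)
    | E i \<Rightarrow> var (E (r_act 0 i)))"

definition flip :: "'k::field gen_poly \<Rightarrow> 'k gen_poly"
  where "flip = nc_subst flip_gen"

lemma flip_hom: "ncpoly_hom flip"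
  and flip_const [simp]: "flip (Poly_Mapping.single 0 k) = Poly_Mapping.single 0 k"
  unfolding flip_def by (rule nc_subst_hom nc_subst_const)+

lemma flip_E [simp]: "flip (\<ee> i) = \<ee> (r_act 0 i)"
  and flip_Y1 [simp]: "flip (\<yy> (Suc 0)) = - \<yy> (Suc 0)"
  and flip_Y [simp]: "j \<noteq> Suc 0 \<Longrightarrow> flip (\<yy> j) = \<yy> j"
  and flip_Psi0 [simp]: "flip (\<psi> 0) = \<psi> (Suc 0)"
  and flip_Psi1 [simp]: "flip (\<psi> (Suc 0)) = \<psi> 0"
  and flip_Psi [simp]: "1 < a \<Longrightarrow> flip (\<psi> a) = \<psi> a"
  by (simp_all add: flip_def flip_gen_def)

lemmas flip_simps = ncpoly_hom.hom_simps[OF flip_hom]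

lemma r_act_0_r_act_0 [simp]: "r_act 0 (r_act 0 i) = i"
  by (simp add: r_act_def)

lemma r_act_0_app: "r_act 0 i j = (if j = 1 then inverse (i 1) else i j)"
  by (simp add: r_act_def)

lemma flip_flip [simp]: "flip (flip x) = x"
proof (rule ncpoly_hom_agree[OF ncpoly_hom_compose[OF flip_hom flip_hom] ncpoly_hom_id])
  show "x \<in> free_carrier UNIV" by simp
  show "flip (flip (var g)) = var g" for g
  proof (cases g)
    case (Psi a)
    then show ?thesis by (cases "a = 0 \<or> a = Suc 0") auto
  next
    case (Y j)
    then show ?thesis by (cases "j = Suc 0") (simp_all add: flip_simps)
  qed simp
qed simp

text \<open>\<open>Skew a b\<close> stands for \<open>a + b g\<close> in the skew group ring of the group of order two generated by
  \<open>g\<close>, where \<open>g x = flip x g\<close>.\<close>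

context notes [[typedef_overloaded]]
begin
datatype 'k skew = Skew (even_part: "'k::field gen_poly") (odd_part: "'k gen_poly")
end

instantiation skew :: (field) ring_1
begin

definition "0 = Skew 0 0"
definition "1 = Skew 1 0"
definition "x + y = Skew (even_part x + even_part y) (odd_part x + odd_part y)"
definition "x - y = Skew (even_part x - even_part y) (odd_part x - odd_part y)"
definition "- x = Skew (- even_part x) (- odd_part x)"
definition "x * y = Skew (even_part x * even_part y + odd_part x * flip (odd_part y))
  (even_part x * odd_part y + odd_part x * flip (even_part y))"

lemmas skew_defs = zero_skew_def one_skew_def plus_skew_def minus_skew_def uminus_skew_def times_skew_def

instance
  by standard (simp_all add: skew_defs flip_simps algebra_simps)

end

definition embed_gen :: "'k::field gen \<Rightarrow> 'k gen_poly"
  where "embed_gen g = (if g = Psi 0 then \<psi> 0 * \<psi> 1 * \<psi> 0 else var g)"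

definition embed :: "'k::field gen_poly \<Rightarrow> 'k gen_poly"
  where "embed = nc_subst embed_gen"

definition sign_gen :: "'k::field gen \<Rightarrow> 'k gen_poly"
  where "sign_gen g = (if g = Psi 0 then - \<psi> 0 else var g)"

definition sign_change :: "'k::field gen_poly \<Rightarrow> 'k gen_poly"
  where "sign_change = nc_subst sign_gen"

definition to_skew_gen :: "'k::field gen \<Rightarrow> 'k skew"
  where "to_skew_gen g = (if g = Psi 0 then Skew 0 1 else Skew (var g) 0)"

definition to_skew :: "'k::field gen_poly \<Rightarrow> 'k skew"
  where "to_skew = nc_eval (\<lambda>k. Skew (Poly_Mapping.single 0 k) 0) to_skew_gen"

lemma embed_hom: "ncpoly_hom embed"
  and embed_const [simp]: "embed (Poly_Mapping.single 0 k) = Poly_Mapping.single 0 k"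
  and embed_var: "embed (var g) = embed_gen g"
  unfolding embed_def by (rule nc_subst_hom nc_subst_const nc_subst_var)+

lemmas embed_simps = ncpoly_hom.hom_simps[OF embed_hom]

lemma sign_change_hom: "ncpoly_hom sign_change"
  and sign_change_const [simp]: "sign_change (Poly_Mapping.single 0 k) = Poly_Mapping.single 0 k"
  and sign_change_var: "sign_change (var g) = sign_gen g"
  unfolding sign_change_def by (rule nc_subst_hom nc_subst_const nc_subst_var)+

lemmas sign_change_simps = ncpoly_hom.hom_simps[OF sign_change_hom]

lemma central_scalars_skew: "central_scalars (\<lambda>k. Skew (Poly_Mapping.single 0 k) (0::'k::field gen_poly))"
  by standard (simp_all add: skew_defs single_add mult_single const_central flip_simps)

lemma to_skew_hom: "ncpoly_hom to_skew"
  and to_skew_const [simp]: "to_skew (Poly_Mapping.single 0 k) = Skew (Poly_Mapping.single 0 k) 0"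
  and to_skew_var: "to_skew (var g) = to_skew_gen g"
  unfolding to_skew_def
  by (rule central_scalars.nc_eval_hom central_scalars.nc_eval_const
      central_scalars.nc_eval_var central_scalars_skew)+

lemmas to_skew_simps = ncpoly_hom.hom_simps[OF to_skew_hom]

lemma Skew_hom: "ncpoly_hom (\<lambda>x. Skew x 0)"
  by standard (simp_all add: skew_defs flip_simps)

text \<open>The letter \<open>Psi 0\<close> goes to \<open>g \<psi>\<^sub>1 g = flip \<psi>\<^sub>1\<close>, which is \<open>Psi 0\<close> again. Thus \<open>to_skew\<close> is a
  left inverse of \<open>embed\<close> before any relations are imposed.\<close>

lemma to_skew_embed: "to_skew (embed x) = Skew x 0"
  by (rule ncpoly_hom_agree[OF ncpoly_hom_compose[OF to_skew_hom embed_hom] Skew_hom free_carrier_UNIV])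
    (simp_all add: embed_var embed_gen_def to_skew_simps to_skew_var to_skew_gen_def skew_defs flip_simps)

lemma sign_change_sign_change [simp]: "sign_change (sign_change x) = x"
  by (rule ncpoly_hom_agree[OF ncpoly_hom_compose[OF sign_change_hom sign_change_hom]
        ncpoly_hom_id free_carrier_UNIV])
    (simp_all add: sign_change_var sign_gen_def sign_change_simps)

lemma sign_change_embed: "sign_change (embed x) = embed x"
  by (rule ncpoly_hom_agree[OF ncpoly_hom_compose[OF sign_change_hom embed_hom]
        embed_hom free_carrier_UNIV])
    (simp_all add: embed_var embed_gen_def sign_change_var sign_gen_def sign_change_simps)

lemma embed_fix: "x \<in> free_carrier G \<Longrightarrow> Psi 0 \<notin> G \<Longrightarrow> embed x = x"
  unfolding embed_def by (rule nc_subst_fix) (auto simp: embed_gen_def)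

lemma sign_change_fix: "x \<in> free_carrier G \<Longrightarrow> Psi 0 \<notin> G \<Longrightarrow> sign_change x = x"
  unfolding sign_change_def by (rule nc_subst_fix) (auto simp: sign_gen_def)

lemma to_skew_fix: "x \<in> free_carrier G \<Longrightarrow> Psi 0 \<notin> G \<Longrightarrow> to_skew x = Skew x 0"
  using to_skew_embed[of x] by (simp add: embed_fix)

section \<open>Matching the relations of \<open>V\<close> and \<open>W\<close>\<close>

text \<open>The relations of \<open>V\<close> and \<open>W\<close> without the letter \<open>Psi 0\<close>. They hold in both algebras, since
  \<open>r\<^sub>a\<close> and \<open>s\<^sub>a\<close> agree for \<open>a \<ge> 1\<close>. The letters \<open>Psi a\<close> that remain act on tuples
  through the symmetric group, the Weyl group of type A, whence the name.\<close>

definition type_A_rel :: "'k::field \<Rightarrow> nat \<Rightarrow> 'k tuple set \<Rightarrow> ('k \<Rightarrow> nat) \<Rightarrow> ('k gen_poly \<times> 'k gen_poly) set"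
  where "type_A_rel q n \<beta> m = common_rel q n \<beta>
    \<union> {(\<psi> a * \<ee> i, \<ee> (r_act a i) * \<psi> a) |a i. i \<in> \<beta> \<and> a \<in> {1..n-1}}
    \<union> cyclotomic_rel m \<beta>"

text \<open>The general relations have index arguments such as \<open>1 + 1\<close> when specialised to \<open>b = 1\<close>;
  successor form makes them comparable with the literals \<open>2\<close> and \<open>3\<close> of the relations for \<open>Psi 0\<close>.\<close>

lemmas small_numerals = numeral_2_eq_2 numeral_3_eq_3

lemma s_act_eq_r_act: "a \<noteq> 0 \<Longrightarrow> s_act a i = r_act a i"
  by (simp add: s_act_def r_act_def)

lemma s_act_0: "s_act 0 i = r_act 0 (r_act 1 (r_act 0 i))"
  by (rule ext) (auto simp: s_act_def r_act_def numeral_2_eq_2)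

lemma r_act_commute: "1 < a \<Longrightarrow> r_act 0 (r_act a i) = r_act a (r_act 0 i)"
  by (rule ext) (auto simp: r_act_def)

text \<open>Stability under all \<open>r\<^sub>a\<close> keeps the relations among the given generators and makes the flip
  permute the idempotents; the condition on \<open>m\<close> makes it preserve the cyclotomic relations.\<close>

locale stable_tuples =
  fixes q :: "'k::field" and n :: nat and \<beta> :: "'k tuple set" and m :: "'k \<Rightarrow> nat"
  assumes n2: "n \<ge> 2"
    and r_closed: "a < n \<Longrightarrow> i \<in> \<beta> \<Longrightarrow> r_act a i \<in> \<beta>"
    and m_inverse: "i \<in> \<beta> \<Longrightarrow> m (inverse (i 1)) = m (i 1)"
begin

abbreviation "Gens \<equiv> gens n \<beta>"
abbreviation "RelA \<equiv> type_A_rel q n \<beta> m"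

lemma r0_closed: "i \<in> \<beta> \<Longrightarrow> r_act 0 i \<in> \<beta>"
  using r_closed n2 by simp

lemma gens_intros [intro]:
  "a < n \<Longrightarrow> Psi a \<in> Gens" "1 \<le> j \<Longrightarrow> j \<le> n \<Longrightarrow> Y j \<in> Gens" "i \<in> \<beta> \<Longrightarrow> E i \<in> Gens"
  by (auto simp: gens_def)

lemma transpose_range: "j \<in> {1..n} \<Longrightarrow> b \<in> {1..n-1} \<Longrightarrow> Transposition.transpose b (Suc b) j \<in> {1..n}"
  by (auto simp: Transposition.transpose_def)

lemma generator_carrier:
  "a < n \<Longrightarrow> 0 < a \<Longrightarrow> \<psi> a \<in> free_carrier (Gens - {Psi 0})"
  "1 \<le> j \<Longrightarrow> j \<le> n \<Longrightarrow> \<yy> j \<in> free_carrier (Gens - {Psi 0})"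
  "i \<in> \<beta> \<Longrightarrow> \<ee> i \<in> free_carrier (Gens - {Psi 0})"
  "a < n \<Longrightarrow> \<psi> a \<in> free_carrier Gens"
  "1 \<le> j \<Longrightarrow> j \<le> n \<Longrightarrow> \<yy> j \<in> free_carrier Gens"
  "i \<in> \<beta> \<Longrightarrow> \<ee> i \<in> free_carrier Gens"
  by (auto intro!: free_carrier_var gens_intros)

lemmas carrier_intros = generator_carrier free_carrier_mult free_carrier_add free_carrier_diff
  free_carrier_uminus free_carrier_power free_carrier_sum

lemma common_rel_carrier:
  "(u, v) \<in> common_rel q n \<beta> \<Longrightarrow>
    u \<in> free_carrier (Gens - {Psi 0}) \<and> v \<in> free_carrier (Gens - {Psi 0})"
proof (induction u v rule: common_rel.induct)
  case (psi_y i b j)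
  then show ?case using transpose_range[of j b] n2
    by (auto intro!: carrier_intros)
qed (use n2 in \<open>auto intro!: carrier_intros\<close>)

lemma type_A_common: "(u, v) \<in> common_rel q n \<beta> \<Longrightarrow> (u, v) \<in> RelA"
  by (simp add: type_A_rel_def)

lemma type_A_psi_e: "i \<in> \<beta> \<Longrightarrow> a \<in> {1..n-1} \<Longrightarrow> (\<psi> a * \<ee> i, \<ee> (r_act a i) * \<psi> a) \<in> RelA"
  unfolding type_A_rel_def by blast

lemma type_A_rel_cases:
  assumes "(u, v) \<in> RelA"
  obtains "(u, v) \<in> common_rel q n \<beta>"
    | a i where "i \<in> \<beta>" "a \<in> {1..n-1}" "u = \<psi> a * \<ee> i" "v = \<ee> (r_act a i) * \<psi> a"
    | i where "i \<in> \<beta>" "u = \<yy> 1 ^ m (i 1) * \<ee> i" "v = 0"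
  using assms by (auto simp: type_A_rel_def cyclotomic_rel_def)

lemma type_A_rel_carrier:
  assumes "(u, v) \<in> RelA"
  shows "u - v \<in> free_carrier (Gens - {Psi 0})"
  using assms
proof (cases rule: type_A_rel_cases)
  case 1
  then show ?thesis using common_rel_carrier free_carrier_diff by blast
next
  case (2 a i)
  then show ?thesis using r_closed[of a i] n2
    by (auto intro!: carrier_intros)
next
  case (3 i)
  then show ?thesis using n2
    by (auto intro!: carrier_intros)
qed

lemma V_rel_cases:
  assumes "(u, v) \<in> V_rel q n \<beta> \<union> cyclotomic_rel m \<beta>"
  obtains "(u, v) \<in> RelA"
    | i where "i \<in> \<beta>" "u = \<psi> 0 * \<ee> i" "v = \<ee> (r_act 0 i) * \<psi> 0"
    | b where "1 < b" "b < n" "u = \<psi> 0 * \<psi> b" "v = \<psi> b * \<psi> 0"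
    | "u = \<psi> 0 * \<yy> 1 + \<yy> 1 * \<psi> 0" "v = 0"
    | j where "1 < j" "j \<le> n" "u = \<psi> 0 * \<yy> j" "v = \<yy> j * \<psi> 0"
    | "u = \<psi> 0 ^ 2" "v = 1"
    | "u = (\<psi> 0 * \<psi> 1) ^ 2" "v = (\<psi> 1 * \<psi> 0) ^ 2"
  using assms
proof
  assume "(u, v) \<in> V_rel q n \<beta>"
  then show thesis
  proof cases
    case common
    then show thesis using that(1) by (simp add: type_A_rel_def)
  next
    case (psi_e i a)
    show thesis
    proof (cases "a = 0")
      case False
      with psi_e type_A_psi_e[of i a] have "(u, v) \<in> RelA"
        by auto
      then show thesis by (rule that(1))
    qed (use psi_e that(2) in simp)
  next
    case (psi0_psi b)
    then show thesis using that(3) by auto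
  next
    case (psi0_y j)
    then show thesis using that(5) by auto
  qed (use that in simp_all)
qed (use that(1) in \<open>simp add: type_A_rel_def\<close>)

text \<open>Both signs are included because the flip negates \<open>y\<^sub>1\<close> and can thereby turn a relation into its
  negative.\<close>

definition A_diff :: "'k gen_poly set"
  where "A_diff = {u - v |u v. (u, v) \<in> RelA} \<union> {v - u |u v. (u, v) \<in> RelA}"

lemma A_diffI: "(u, v) \<in> RelA \<Longrightarrow> x = u - v \<Longrightarrow> x \<in> A_diff"
  and A_diff_revI: "(u, v) \<in> RelA \<Longrightarrow> x = v - u \<Longrightarrow> x \<in> A_diff"
  by (auto simp: A_diff_def)

lemma A_diff_carrier:
  assumes "x \<in> A_diff"
  shows "x \<in> free_carrier (Gens - {Psi 0})"
proof -
  obtain u v where uv: "(u, v) \<in> RelA" "x = u - v \<or> x = v - u"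
    using assms by (auto simp: A_diff_def)
  from free_carrier_uminus[OF type_A_rel_carrier[OF uv(1)]] type_A_rel_carrier[OF uv(1)] uv(2)
  show ?thesis by auto
qed

text \<open>Each relation for \<open>Psi 0\<close> at the tuple \<open>i\<close> is the flip of the corresponding relation for \<open>Psi 1\<close>
  at \<open>r\<^sub>0 i\<close>, whose first entry is \<open>i\<^sub>1\<^sup>-\<^sup>1\<close>. Commutation of \<open>Psi 0\<close> and \<open>Psi 1\<close> is its own flip up to
  sign and remains as a separate case.\<close>

lemma W_rel_cases:
  assumes "(u, v) \<in> W_rel q n \<beta> \<union> cyclotomic_rel m \<beta>"
  obtains "u - v \<in> A_diff" | "flip (u - v) \<in> A_diff" | "u - v = \<psi> 0 * \<psi> 1 - \<psi> 1 * \<psi> 0"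
  using assms
proof
  assume "(u, v) \<in> W_rel q n \<beta>"
  then show thesis
  proof cases
    case common
    then show thesis using that(1) A_diffI[OF type_A_common] by blast
  next
    case (psi_e i a)
    show thesis
    proof (cases "a = 0")
      case True
      have "(\<psi> 1 * \<ee> (r_act 0 i), \<ee> (r_act 1 (r_act 0 i)) * \<psi> 1) \<in> RelA"
        using psi_e n2 r0_closed[of i] by (intro type_A_psi_e) auto
      then have "flip (u - v) \<in> A_diff"
        by (rule A_diffI) (simp add: psi_e True flip_simps s_act_0)
      then show thesis by (rule that(2))
    next
      case False
      then have "(u, v) \<in> RelA"
        using psi_e type_A_psi_e[of i a] by (auto simp: s_act_eq_r_act)
      then show thesis using that(1) A_diffI by blast
    qed
  next
    case (psi0_y i j)
    note rel = type_A_common[OF common_rel.psi_y[of "r_act 0 i" \<beta> 1 n j q]]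
    have "flip (u - v) \<in> A_diff"
    proof (cases "j = 1")
      case True
      show ?thesis
        by (rule A_diff_revI[OF rel])
          (use psi0_y n2 r0_closed[of i] True in \<open>auto simp: r_act_0_app small_numerals flip_simps algebra_simps\<close>)
    next
      case False
      show ?thesis
        by (rule A_diffI[OF rel])
          (use psi0_y n2 r0_closed[of i] False in
            \<open>auto simp: r_act_0_app small_numerals flip_simps algebra_simps Transposition.transpose_def\<close>)
    qed
    then show thesis by (rule that(2))
  next
    case (psi0_psi b)
    show thesis
    proof (cases "b = 1")
      case False
      have "flip (u - v) \<in> A_diff"
        by (rule A_diffI[OF type_A_common[OF common_rel.psi_comm[of 1 n b]]])
          (use psi0_psi n2 False in \<open>auto simp: flip_simps\<close>)
      then show thesis by (rule that(2))
    qed (use psi0_psi that(3) in simp)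
  next
    case (psi0_sq_eq i)
    have "flip (u - v) \<in> A_diff"
      by (rule A_diffI[OF type_A_common[OF common_rel.psi_sq_eq[of "r_act 0 i" \<beta> 1 n q]]])
        (use psi0_sq_eq n2 r0_closed[of i] in \<open>auto simp: r_act_0_app small_numerals flip_simps\<close>)
    then show thesis by (rule that(2))
  next
    case (psi0_sq_none i)
    have "flip (u - v) \<in> A_diff"
      by (rule A_diffI[OF type_A_common[OF common_rel.psi_sq_none[of "r_act 0 i" \<beta> 1 n q]]])
        (use psi0_sq_none n2 r0_closed[of i] in \<open>auto simp: r_act_0_app small_numerals flip_simps\<close>)
    then show thesis by (rule that(2))
  next
    case (psi0_sq_right i)
    have "flip (u - v) \<in> A_diff"
      by (rule A_diffI[OF type_A_common[OF common_rel.psi_sq_right[of "r_act 0 i" \<beta> 1 n q]]])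
        (use psi0_sq_right n2 r0_closed[of i] in \<open>auto simp: r_act_0_app small_numerals flip_simps\<close>)
    then show thesis by (rule that(2))
  next
    case (psi0_sq_left i)
    have "flip (u - v) \<in> A_diff"
      by (rule A_diffI[OF type_A_common[OF common_rel.psi_sq_left[of "r_act 0 i" \<beta> 1 n q]]])
        (use psi0_sq_left n2 r0_closed[of i] in \<open>auto simp: r_act_0_app small_numerals flip_simps ring_distribs\<close>)
    then show thesis by (rule that(2))
  next
    case (psi0_sq_double i)
    have "flip (u - v) \<in> A_diff"
      by (rule A_diffI[OF type_A_common[OF common_rel.psi_sq_double[of "r_act 0 i" \<beta> 1 n q]]])
        (use psi0_sq_double n2 r0_closed[of i] in \<open>auto simp: r_act_0_app small_numerals flip_simps ring_distribs\<close>)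
    then show thesis by (rule that(2))
  next
    case (psi0_braid i)
    have "flip (u - v) \<in> A_diff"
      by (rule A_diffI[OF type_A_common[OF common_rel.psi_braid[of "r_act 0 i" \<beta> 1 n q]]])
        (use psi0_braid n2 r0_closed[of i] in \<open>auto simp: r_act_0_app small_numerals flip_simps\<close>)
    then show thesis by (rule that(2))
  qed
qed (use that(1) A_diffI[of u v] in \<open>simp add: type_A_rel_def\<close>)

lemma flip_carrier: "x \<in> free_carrier Gens \<Longrightarrow> flip x \<in> free_carrier Gens"
  unfolding flip_def
proof (rule nc_subst_carrier)
  show "flip_gen g \<in> free_carrier Gens" if "g \<in> Gens" for g
    using that n2
    by (auto simp: gens_def flip_gen_def Transposition.transpose_def
        intro!: free_carrier_var free_carrier_uminus r0_closed)
qed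

lemma A_diff_carrier_gens: "x \<in> A_diff \<Longrightarrow> x \<in> free_carrier Gens"
  using A_diff_carrier free_carrier_mono by blast

lemma presentation_V: "presentation Gens (V_rel q n \<beta> \<union> cyclotomic_rel m \<beta>)"
proof
  fix u v assume "(u, v) \<in> V_rel q n \<beta> \<union> cyclotomic_rel m \<beta>"
  then show "u - v \<in> free_carrier Gens"
  proof (cases rule: V_rel_cases)
    case 1
    then show ?thesis using A_diffI A_diff_carrier_gens by blast
  qed (use n2 r0_closed in \<open>auto intro!: carrier_intros\<close>)
qed

lemma presentation_W: "presentation Gens (W_rel q n \<beta> \<union> cyclotomic_rel m \<beta>)"
proof
  fix u v assume "(u, v) \<in> W_rel q n \<beta> \<union> cyclotomic_rel m \<beta>"
  then show "u - v \<in> free_carrier Gens"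
  proof (cases rule: W_rel_cases)
    case 1
    then show ?thesis by (rule A_diff_carrier_gens)
  next
    case 2
    from flip_carrier[OF A_diff_carrier_gens[OF this]] show ?thesis by simp
  next
    case 3
    then show ?thesis using n2 by (auto intro!: carrier_intros)
  qed
qed

sublocale V: presentation "gens n \<beta>" "V_rel q n \<beta> \<union> cyclotomic_rel m \<beta>"
  by (rule presentation_V)

sublocale W: presentation "gens n \<beta>" "W_rel q n \<beta> \<union> cyclotomic_rel m \<beta>"
  by (rule presentation_W)

lemma W_common: "(u, v) \<in> common_rel q n \<beta> \<Longrightarrow> (u, v) \<in> W_rel q n \<beta>"
  using W_rel.common[where uv = "(u, v)"] by simp

lemma W_I_relI: "(u, v) \<in> W_rel q n \<beta> \<Longrightarrow> x = u - v \<Longrightarrow> x \<in> W.I"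
  and W_I_rel_revI: "(u, v) \<in> W_rel q n \<beta> \<Longrightarrow> x = v - u \<Longrightarrow> x \<in> W.I"
  using W.I_rel[of u v] W.I_rel'[of u v] by auto

text \<open>The relations that involve \<open>Psi 1\<close> flip to those for \<open>Psi 0\<close> at the tuple \<open>r\<^sub>0 i\<close>; the others
  flip to relations of the same kind there, up to a sign that comes from \<open>y\<^sub>1\<close>.\<close>

lemma flip_common_rel: "(u, v) \<in> common_rel q n \<beta> \<Longrightarrow> flip (u - v) \<in> W.I"
proof (induction u v rule: common_rel.induct)
  case e_sum
  have "(\<Sum>i\<in>\<beta>. \<ee> (r_act 0 i)) = (\<Sum>i\<in>\<beta>. \<ee> i :: 'k gen_poly)"
    by (rule sum.reindex_bij_witness[of _ "r_act 0" "r_act 0"]) (auto intro: r0_closed)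
  then show ?case
    by (intro W_I_relI[OF W_common[OF common_rel.e_sum]]) (simp add: flip_simps)
next
  case (e_e i j)
  moreover have "r_act 0 i = r_act 0 j \<longleftrightarrow> i = j"
    by (metis r_act_0_r_act_0)
  ultimately show ?case
    by (intro W_I_relI[OF W_common[OF common_rel.e_e[of "r_act 0 i" \<beta> "r_act 0 j"]]])
      (auto simp: flip_simps r0_closed)
next
  case (y_y j k)
  show ?case
  proof (cases "(j = 1) = (k = 1)")
    case True
    then show ?thesis
      by (intro W_I_relI[OF W_common[OF common_rel.y_y[of j n k]]]) (use y_y in \<open>auto simp: flip_simps\<close>)
  next
    case False
    then show ?thesis
      by (intro W_I_rel_revI[OF W_common[OF common_rel.y_y[of j n k]]]) (use y_y in \<open>auto simp: flip_simps\<close>)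
  qed
next
  case (y_e i j)
  show ?case
  proof (cases "j = 1")
    case True
    then show ?thesis
      by (intro W_I_rel_revI[OF W_common[OF common_rel.y_e[of "r_act 0 i" \<beta> j n]]])
        (use y_e in \<open>auto simp: flip_simps r0_closed\<close>)
  next
    case False
    then show ?thesis
      by (intro W_I_relI[OF W_common[OF common_rel.y_e[of "r_act 0 i" \<beta> j n]]])
        (use y_e in \<open>auto simp: flip_simps r0_closed\<close>)
  qed
next
  case (psi_y i b j)
  show ?case
  proof (cases "b = 1")
    case True
    show ?thesis
    proof (cases "j = 1")
      case j: True
      show ?thesis
        by (intro W_I_rel_revI[OF W_rel.psi0_y[of "r_act 0 i" \<beta> j n]])
          (use psi_y True j in \<open>auto simp: flip_simps r0_closed r_act_0_app small_numerals algebra_simps\<close>)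
    next
      case j: False
      show ?thesis
        by (intro W_I_relI[OF W_rel.psi0_y[of "r_act 0 i" \<beta> j n]])
          (use psi_y True j in \<open>auto simp: flip_simps r0_closed r_act_0_app small_numerals algebra_simps
            Transposition.transpose_def\<close>)
    qed
  next
    case False
    show ?thesis
    proof (cases "j = 1")
      case j: True
      show ?thesis
        by (intro W_I_rel_revI[OF W_common[OF common_rel.psi_y[of "r_act 0 i" \<beta> b n j]]])
          (use psi_y False j in \<open>auto simp: flip_simps r0_closed r_act_0_app algebra_simps
            Transposition.transpose_def\<close>)
    next
      case j: False
      show ?thesis
        by (intro W_I_relI[OF W_common[OF common_rel.psi_y[of "r_act 0 i" \<beta> b n j]]])
          (use psi_y False j in \<open>auto simp: flip_simps r0_closed r_act_0_app algebra_simps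
            Transposition.transpose_def\<close>)
    qed
  qed
next
  case (psi_comm b c)
  consider "b = 1" | "c = 1" | "b > 1" "c > 1"
    using psi_comm by fastforce
  then show ?case
  proof cases
    case 1
    then show ?thesis
      by (intro W_I_relI[OF W_rel.psi0_psi[of c n]]) (use psi_comm in \<open>auto simp: flip_simps\<close>)
  next
    case 2
    then show ?thesis
      by (intro W_I_rel_revI[OF W_rel.psi0_psi[of b n]]) (use psi_comm in \<open>auto simp: flip_simps\<close>)
  next
    case 3
    then show ?thesis
      by (intro W_I_relI[OF W_common[OF common_rel.psi_comm[of b n c]]])
        (use psi_comm in \<open>auto simp: flip_simps\<close>)
  qed
next
  case (psi_sq_eq i b)
  show ?case
  proof (cases "b = 1")
    case True
    show ?thesis
      by (intro W_I_relI[OF W_rel.psi0_sq_eq[of "r_act 0 i" \<beta>]])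
        (use psi_sq_eq True in \<open>auto simp: flip_simps r0_closed r_act_0_app small_numerals\<close>)
  next
    case False
    show ?thesis
      by (intro W_I_relI[OF W_common[OF common_rel.psi_sq_eq[of "r_act 0 i" \<beta> b n]]])
        (use psi_sq_eq False in \<open>auto simp: flip_simps r0_closed r_act_0_app\<close>)
  qed
next
  case (psi_sq_none i b)
  show ?case
  proof (cases "b = 1")
    case True
    show ?thesis
      by (intro W_I_relI[OF W_rel.psi0_sq_none[of "r_act 0 i" \<beta>]])
        (use psi_sq_none True in \<open>auto simp: flip_simps r0_closed r_act_0_app small_numerals\<close>)
  next
    case False
    show ?thesis
      by (intro W_I_relI[OF W_common[OF common_rel.psi_sq_none[of "r_act 0 i" \<beta> b n]]])
        (use psi_sq_none False in \<open>auto simp: flip_simps r0_closed r_act_0_app\<close>)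
  qed
next
  case (psi_sq_right i b)
  show ?case
  proof (cases "b = 1")
    case True
    show ?thesis
      by (intro W_I_relI[OF W_rel.psi0_sq_right[of "r_act 0 i" \<beta>]])
        (use psi_sq_right True in \<open>auto simp: flip_simps r0_closed r_act_0_app small_numerals algebra_simps\<close>)
  next
    case False
    show ?thesis
      by (intro W_I_relI[OF W_common[OF common_rel.psi_sq_right[of "r_act 0 i" \<beta> b n]]])
        (use psi_sq_right False in \<open>auto simp: flip_simps r0_closed r_act_0_app\<close>)
  qed
next
  case (psi_sq_left i b)
  show ?case
  proof (cases "b = 1")
    case True
    show ?thesis
      by (intro W_I_relI[OF W_rel.psi0_sq_left[of "r_act 0 i" \<beta>]])
        (use psi_sq_left True in \<open>auto simp: flip_simps r0_closed r_act_0_app small_numerals algebra_simps\<close>)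
  next
    case False
    show ?thesis
      by (intro W_I_relI[OF W_common[OF common_rel.psi_sq_left[of "r_act 0 i" \<beta> b n]]])
        (use psi_sq_left False in \<open>auto simp: flip_simps r0_closed r_act_0_app\<close>)
  qed
next
  case (psi_sq_double i b)
  show ?case
  proof (cases "b = 1")
    case True
    show ?thesis
      by (intro W_I_relI[OF W_rel.psi0_sq_double[of "r_act 0 i" \<beta>]])
        (use psi_sq_double True in \<open>auto simp: flip_simps r0_closed r_act_0_app small_numerals algebra_simps\<close>)
  next
    case False
    show ?thesis
      by (intro W_I_relI[OF W_common[OF common_rel.psi_sq_double[of "r_act 0 i" \<beta> b n]]])
        (use psi_sq_double False in \<open>auto simp: flip_simps r0_closed r_act_0_app\<close>)
  qed
next
  case (psi_braid i b)
  show ?case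
  proof (cases "b = 1")
    case True
    show ?thesis
      by (intro W_I_relI[OF W_rel.psi0_braid[of "r_act 0 i" \<beta>]])
        (use psi_braid True in \<open>auto simp: flip_simps r0_closed r_act_0_app small_numerals\<close>)
  next
    case False
    show ?thesis
      by (intro W_I_relI[OF W_common[OF common_rel.psi_braid[of "r_act 0 i" \<beta> b n]]])
        (use psi_braid False in \<open>auto simp: flip_simps r0_closed r_act_0_app\<close>)
  qed
qed

section \<open>The ideals of relations under the substitutions\<close>

lemma type_A_W:
  assumes "(u, v) \<in> RelA"
  shows "u - v \<in> W.I"
proof (rule W.I_rel)
  show "(u, v) \<in> W_rel q n \<beta> \<union> cyclotomic_rel m \<beta>"
    using assms
  proof (cases rule: type_A_rel_cases)
    case 1
    then show ?thesis using W_common by blast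
  next
    case (2 a i)
    then show ?thesis using W_rel.psi_e[of i \<beta> a n q] by (auto simp: s_act_eq_r_act)
  next
    case (3 i)
    then show ?thesis by (auto simp: cyclotomic_rel_def)
  qed
qed

lemma type_A_V:
  assumes "(u, v) \<in> RelA"
  shows "u - v \<in> V.I"
proof (rule V.I_rel)
  show "(u, v) \<in> V_rel q n \<beta> \<union> cyclotomic_rel m \<beta>"
    using assms
  proof (cases rule: type_A_rel_cases)
    case 1
    then show ?thesis using V_rel.common[where uv = "(u, v)"] by simp
  next
    case (2 a i)
    then show ?thesis using V_rel.psi_e[of i \<beta> a n q] by auto
  next
    case (3 i)
    then show ?thesis by (auto simp: cyclotomic_rel_def)
  qed
qed

lemma A_diff_V: "x \<in> A_diff \<Longrightarrow> x \<in> V.I"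
  using type_A_V V.I_uminus[OF type_A_V] by (auto simp: A_diff_def)

lemma flip_type_A:
  assumes "(u, v) \<in> RelA"
  shows "flip (u - v) \<in> W.I"
  using assms
proof (cases rule: type_A_rel_cases)
  case 1
  then show ?thesis by (rule flip_common_rel)
next
  case (2 a i)
  show ?thesis
  proof (cases "a = 1")
    case True
    show ?thesis
      by (rule W_I_relI[OF W_rel.psi_e[of "r_act 0 i" \<beta> 0 n]])
        (use 2 True in \<open>auto simp: flip_simps r0_closed s_act_0\<close>)
  next
    case False
    with 2(2) have a: "1 < a" by simp
    show ?thesis
      by (rule W_I_relI[OF W_rel.psi_e[of "r_act 0 i" \<beta> a n]])
        (use 2 a in \<open>auto simp: flip_simps r0_closed s_act_eq_r_act r_act_commute\<close>)
  qed
next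
  case (3 i)
  have "m (r_act 0 i 1) = m (i 1)"
    using m_inverse[OF 3(1)] by (simp add: r_act_0_app)
  then have "(\<yy> 1 ^ m (i 1) * \<ee> (r_act 0 i), 0) \<in> W_rel q n \<beta> \<union> cyclotomic_rel m \<beta>"
    using r0_closed[OF 3(1)] unfolding cyclotomic_rel_def by force
  from W.I_rel[OF this] have "\<yy> 1 ^ m (i 1) * \<ee> (r_act 0 i) \<in> W.I"
    by simp
  \<comment> \<open>the power of \<open>-1\<close> arises because the flip negates \<open>y\<^sub>1\<close>\<close>
  then have "(-1) ^ m (i 1) * (\<yy> 1 ^ m (i 1) * \<ee> (r_act 0 i)) \<in> W.I"
    by (rule W.I_mult_left) (auto intro!: free_carrier_power free_carrier_uminus)
  then show ?thesis
    by (simp add: 3 flip_simps power_minus[of "\<yy> (Suc 0)"] mult.assoc)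
qed

text \<open>A relation for \<open>Psi 0\<close> is the flip of one without \<open>Psi 0\<close>, to which the flip, being an involution,
  returns it; the flips of the relations without \<open>Psi 0\<close> are known to lie in \<open>I\<^sub>W\<close>.\<close>

lemma flip_W_I:
  assumes "x \<in> W.I"
  shows "flip x \<in> W.I"
proof (rule W.hom_image_I[OF flip_hom assms])
  fix u v assume "(u, v) \<in> W_rel q n \<beta> \<union> cyclotomic_rel m \<beta>"
  then show "flip (u - v) \<in> W.I"
  proof (cases rule: W_rel_cases)
    case 1
    then obtain u' v' where uv: "(u', v') \<in> RelA" "u - v = u' - v' \<or> u - v = - (u' - v')"
      by (auto simp: A_diff_def)
    then have "flip (u - v) = flip (u' - v') \<or> flip (u - v) = - flip (u' - v')"
      by (metis ncpoly_hom.hom_uminus[OF flip_hom])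
    then show ?thesis
      using flip_type_A[OF uv(1)] W.I_uminus[OF flip_type_A[OF uv(1)]] by metis
  next
    case 2
    then show ?thesis
      using type_A_W W.I_uminus[OF type_A_W] by (auto simp: A_diff_def)
  next
    case 3
    have "flip (u - v) = - (\<psi> 0 * \<psi> 1 - \<psi> 1 * \<psi> 0)"
      by (simp add: 3 flip_simps)
    also have "\<dots> \<in> W.I"
      using W_I_relI[OF W_rel.psi0_psi[of 1 n q \<beta>] refl] n2 by (intro W.I_uminus) simp
    finally show ?thesis .
  qed
qed (auto intro: W.I_mult_left W.I_mult_right flip_carrier)

lemma embed_carrier: "x \<in> free_carrier Gens \<Longrightarrow> embed x \<in> free_carrier Gens"
  unfolding embed_def
  by (rule nc_subst_carrier) (use n2 in \<open>auto simp: embed_gen_def intro!: carrier_intros\<close>)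

lemma psi0_carrier: "\<psi> 0 \<in> free_carrier Gens"
  using n2 by (auto intro!: carrier_intros)

lemma V_rel_I: "(u, v) \<in> V_rel q n \<beta> \<Longrightarrow> u - v \<in> V.I"
  by (rule V.I_rel) simp

lemma psi0_sq: "\<psi> 0 * \<psi> 0 - 1 \<in> V.I"
  using V_rel_I[OF V_rel.psi0_sq] by (simp add: power2_eq_square)

text \<open>This is \<open>g x = flip x g\<close> inside \<open>V\<close>. Both sides are multiplicative in \<open>x\<close>, so it suffices to
  check generators, where it amounts to the relations of \<open>V\<close> that involve \<open>\<psi>\<^sub>0\<close>.\<close>

lemma psi0_embed:
  assumes "x \<in> free_carrier Gens"
  shows "\<psi> 0 * embed x - embed (flip x) * \<psi> 0 \<in> V.I"
  using assms
proof (induction rule: free_carrier_induct)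
  case (const k)
  show ?case by (simp add: const_central)
next
  case (add x y)
  have "\<psi> 0 * embed (x + y) - embed (flip (x + y)) * \<psi> 0 =
      (\<psi> 0 * embed x - embed (flip x) * \<psi> 0) + (\<psi> 0 * embed y - embed (flip y) * \<psi> 0)"
    by (simp add: flip_simps embed_simps algebra_simps)
  then show ?case using V.I_add[OF add(3,4)] by simp
next
  case (gen g x)
  have g: "\<psi> 0 * embed (var g) - embed (flip (var g)) * \<psi> 0 \<in> V.I"
  proof (cases g)
    case (Psi a)
    consider "a = 0" | "a = 1" | "1 < a" by linarith
    then show ?thesis
    proof cases
      case 1
      have "(\<psi> 0 * \<psi> 0 - 1) * (\<psi> 1 * \<psi> 0) \<in> V.I"
        using n2 by (intro V.I_mult_right[OF psi0_sq]) (auto intro!: carrier_intros)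
      then show ?thesis
        by (simp add: Psi 1 embed_var embed_gen_def algebra_simps)
    next
      case 2
      have "\<psi> 0 * \<psi> 1 * - (\<psi> 0 * \<psi> 0 - 1) \<in> V.I"
        using n2 by (intro V.I_mult_left[OF V.I_uminus[OF psi0_sq]]) (auto intro!: carrier_intros)
      then show ?thesis
        by (simp add: Psi 2 embed_var embed_gen_def algebra_simps)
    next
      case 3
      have "\<psi> 0 * \<psi> a - \<psi> a * \<psi> 0 \<in> V.I"
        using gen(1) 3 by (intro V_rel_I V_rel.psi0_psi) (auto simp: Psi gens_def)
      then show ?thesis
        using 3 by (simp add: Psi embed_var embed_gen_def)
    qed
  next
    case (Y j)
    show ?thesis
    proof (cases "j = 1")
      case True
      show ?thesis
        using V_rel_I[OF V_rel.psi0_y1]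
        by (simp add: Y True embed_var embed_gen_def embed_simps)
    next
      case False
      then have "\<psi> 0 * \<yy> j - \<yy> j * \<psi> 0 \<in> V.I"
        using gen(1) by (intro V_rel_I V_rel.psi0_y) (auto simp: Y gens_def)
      then show ?thesis
        using False by (simp add: Y embed_var embed_gen_def)
    qed
  next
    case (E i)
    then have "\<psi> 0 * \<ee> i - \<ee> (r_act 0 i) * \<psi> 0 \<in> V.I"
      using gen(1) by (intro V_rel_I V_rel.psi_e) (auto simp: gens_def)
    then show ?thesis
      by (simp add: E embed_var embed_gen_def)
  qed
  have "\<psi> 0 * embed (var g * x) - embed (flip (var g * x)) * \<psi> 0 =
      (\<psi> 0 * embed (var g) - embed (flip (var g)) * \<psi> 0) * embed x
      + embed (flip (var g)) * (\<psi> 0 * embed x - embed (flip x) * \<psi> 0)"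
    by (simp add: flip_simps embed_simps algebra_simps)
  also have "\<dots> \<in> V.I"
    using gen(1,2)
    by (intro V.I_add V.I_mult_right[OF g] V.I_mult_left[OF gen(3)] embed_carrier flip_carrier) auto
  finally show ?case .
qed

text \<open>Modulo \<open>I\<^sub>V\<close>, \<open>embed (flip x)\<close> is the conjugate of \<open>embed x\<close> by \<open>\<psi>\<^sub>0\<close>, and so vanishes
  together with \<open>embed x\<close>.\<close>

lemma embed_flip_I:
  assumes "x \<in> free_carrier Gens" "embed x \<in> V.I"
  shows "embed (flip x) \<in> V.I"
proof -
  let ?y = "embed (flip x)"
  have y: "?y \<in> free_carrier Gens"
    by (intro embed_carrier flip_carrier assms(1))
  have "\<psi> 0 * embed x * \<psi> 0 - (\<psi> 0 * embed x - ?y * \<psi> 0) * \<psi> 0 - ?y * (\<psi> 0 * \<psi> 0 - 1) \<in> V.I"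
    by (intro V.I_diff V.I_mult_right[OF psi0_embed] V.I_mult_right[OF V.I_mult_left]
        V.I_mult_left[OF psi0_sq] assms psi0_carrier y)
  then show ?thesis
    by (simp add: algebra_simps)
qed

lemma embed_A_diff: "x \<in> A_diff \<Longrightarrow> embed x = x"
  by (rule embed_fix[OF A_diff_carrier]) simp_all

lemma embed_W_I:
  assumes "x \<in> W.I"
  shows "embed x \<in> V.I"
proof (rule W.hom_image_I[OF embed_hom assms])
  fix u v assume "(u, v) \<in> W_rel q n \<beta> \<union> cyclotomic_rel m \<beta>"
  then show "embed (u - v) \<in> V.I"
  proof (cases rule: W_rel_cases)
    case 1
    then show ?thesis by (simp add: embed_A_diff A_diff_V)
  next
    case 2
    have "embed (flip (flip (u - v))) \<in> V.I"
      by (rule embed_flip_I[OF A_diff_carrier_gens[OF 2]]) (simp add: 2 embed_A_diff A_diff_V)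
    then show ?thesis by simp
  next
    case 3
    then show ?thesis
      using V_rel_I[OF V_rel.psi0_braid]
      by (simp add: embed_simps embed_var embed_gen_def power2_eq_square mult.assoc)
  qed
qed (auto intro: V.I_mult_left V.I_mult_right embed_carrier)

lemma sign_change_carrier: "x \<in> free_carrier Gens \<Longrightarrow> sign_change x \<in> free_carrier Gens"
  unfolding sign_change_def
  by (rule nc_subst_carrier) (auto simp: sign_gen_def intro!: free_carrier_uminus)

lemma sign_change_V_I:
  assumes "x \<in> V.I"
  shows "sign_change x \<in> V.I"
proof (rule V.hom_image_I[OF sign_change_hom assms])
  fix u v assume uv: "(u, v) \<in> V_rel q n \<beta> \<union> cyclotomic_rel m \<beta>"
  from uv have I: "u - v \<in> V.I" by (rule V.I_rel)
  have "sign_change (u - v) = u - v \<or> sign_change (u - v) = - (u - v)"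
    using uv
  proof (cases rule: V_rel_cases)
    case 1
    then have "sign_change (u - v) = u - v"
      by (intro sign_change_fix[OF type_A_rel_carrier]) simp_all
    then show ?thesis ..
  qed (simp_all add: sign_change_simps sign_change_var sign_gen_def power2_eq_square)
  then show "sign_change (u - v) \<in> V.I"
    using V.I_uminus[OF I] I by metis
qed (auto intro: V.I_mult_left V.I_mult_right sign_change_carrier)

lemma to_skew_carrier:
  "x \<in> free_carrier Gens \<Longrightarrow>
    even_part (to_skew x) \<in> free_carrier Gens \<and> odd_part (to_skew x) \<in> free_carrier Gens"
proof (induction rule: free_carrier_induct)
  case (gen g x)
  then show ?case
    by (auto simp: to_skew_simps to_skew_var to_skew_gen_def times_skew_def
        flip_simps intro!: free_carrier_mult free_carrier_add flip_carrier)
qed (auto simp: to_skew_simps plus_skew_def)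

text \<open>The set of pairs over \<open>I\<^sub>W\<close> is closed under multiplication on the left by \<open>g\<close> only because
  \<open>I\<^sub>W\<close> is stable under the flip. Apart from the relations shared with \<open>W\<close>, the only relation of \<open>V\<close>
  that does not already hold in the skew group ring over the free algebra is the braid relation of
  length four; it yields \<open>\<Psi>\<^sub>0 \<Psi>\<^sub>1 = \<Psi>\<^sub>1 \<Psi>\<^sub>0\<close>.\<close>

lemma to_skew_V_I:
  assumes "x \<in> V.I"
  shows "to_skew x \<in> {z. even_part z \<in> W.I \<and> odd_part z \<in> W.I}"
proof (rule V.hom_image_I[OF to_skew_hom assms])
  fix u v assume uv: "(u, v) \<in> V_rel q n \<beta> \<union> cyclotomic_rel m \<beta>"
  then show "to_skew (u - v) \<in> {z. even_part z \<in> W.I \<and> odd_part z \<in> W.I}"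
  proof (cases rule: V_rel_cases)
    case 1
    then have "to_skew (u - v) = Skew (u - v) 0"
      by (intro to_skew_fix[OF type_A_rel_carrier]) simp_all
    then show ?thesis using type_A_W[OF 1] by simp
  next
    case 7
    have "to_skew (u - v) = Skew (\<psi> 0 * \<psi> 1 - \<psi> 1 * \<psi> 0) 0"
      by (simp add: 7 to_skew_simps to_skew_var to_skew_gen_def skew_defs flip_simps power2_eq_square)
    moreover have "\<psi> 0 * \<psi> 1 - \<psi> 1 * \<psi> 0 \<in> W.I"
      by (rule W_I_relI[OF W_rel.psi0_psi[of 1 n]]) (use n2 in auto)
    ultimately show ?thesis by simp
  qed (simp_all add: to_skew_simps to_skew_var to_skew_gen_def skew_defs flip_simps power2_eq_square)
next
  fix z and y :: "'k gen_poly"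
  assume z: "z \<in> {z. even_part z \<in> W.I \<and> odd_part z \<in> W.I}" and y: "y \<in> free_carrier Gens"
  show "to_skew y * z \<in> {z. even_part z \<in> W.I \<and> odd_part z \<in> W.I}"
    using z to_skew_carrier[OF y]
    by (auto simp: times_skew_def intro!: W.I_add W.I_mult_left flip_W_I)
  show "z * to_skew y \<in> {z. even_part z \<in> W.I \<and> odd_part z \<in> W.I}"
    using z to_skew_carrier[OF y]
    by (auto simp: times_skew_def intro!: W.I_add W.I_mult_right flip_carrier)
qed (auto simp: skew_defs)

lemma embed_I_iff: "embed x \<in> V.I \<longleftrightarrow> x \<in> W.I"
  using embed_W_I[of x] to_skew_V_I[of "embed x"] by (auto simp: to_skew_embed)

text \<open>The elements of this form contain the constants and, as \<open>\<psi>\<^sub>0\<close> can be moved past \<open>embed\<close> at the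
  price of a flip, are stable under multiplication on the left by each generator.\<close>

lemma embed_decomposition:
  assumes "x \<in> free_carrier Gens"
  obtains a b where "a \<in> free_carrier Gens" "b \<in> free_carrier Gens"
    "x - (embed a + embed b * \<psi> 0) \<in> V.I"
proof -
  have "\<exists>a\<in>free_carrier Gens. \<exists>b\<in>free_carrier Gens. x - (embed a + embed b * \<psi> 0) \<in> V.I"
    using assms
  proof (induction rule: free_carrier_induct)
    case (const k)
    show ?case
      by (rule bexI[of _ "Poly_Mapping.single 0 k"], rule bexI[of _ 0]) (auto simp: embed_simps)
  next
    case (add x y)
    then obtain a b a' b' where ab: "a \<in> free_carrier Gens" "b \<in> free_carrier Gens"
        "x - (embed a + embed b * \<psi> 0) \<in> V.I"
      and ab': "a' \<in> free_carrier Gens" "b' \<in> free_carrier Gens"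
        "y - (embed a' + embed b' * \<psi> 0) \<in> V.I"
      by blast
    show ?case
      by (rule bexI[of _ "a + a'"], rule bexI[of _ "b + b'"])
        (use V.I_add[OF ab(3) ab'(3)] ab(1,2) ab'(1,2) in \<open>auto simp: embed_simps algebra_simps\<close>)
  next
    case (gen g x)
    then obtain a b where ab: "a \<in> free_carrier Gens" "b \<in> free_carrier Gens"
        "x - (embed a + embed b * \<psi> 0) \<in> V.I"
      by blast
    have gx: "var g * (x - (embed a + embed b * \<psi> 0)) \<in> V.I"
      by (rule V.I_mult_left[OF ab(3)]) (use gen in auto)
    show ?case
    proof (cases "g = Psi 0")
      case False
      show ?thesis
        by (rule bexI[of _ "var g * a"], rule bexI[of _ "var g * b"])
          (use gx ab(1,2) gen(1) False in
            \<open>auto simp: embed_simps embed_var embed_gen_def algebra_simps\<close>)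
    next
      case True
      have "\<psi> 0 * (x - (embed a + embed b * \<psi> 0))
          + (\<psi> 0 * embed a - embed (flip a) * \<psi> 0)
          + (\<psi> 0 * embed b - embed (flip b) * \<psi> 0) * \<psi> 0
          + embed (flip b) * (\<psi> 0 * \<psi> 0 - 1) \<in> V.I"
        using gx ab(1,2) True
        by (intro V.I_add V.I_mult_right[OF psi0_embed] V.I_mult_left[OF psi0_sq] psi0_embed
            psi0_carrier embed_carrier flip_carrier) simp_all
      then show ?thesis
        by (intro bexI[of _ "flip b"] bexI[of _ "flip a"])
          (use ab(1,2) True in \<open>auto simp: algebra_simps intro: flip_carrier\<close>)
    qed
  qed
  then show thesis using that by blast
qed

text \<open>Write \<open>x\<close> as \<open>embed a + embed b \<psi>\<^sub>0\<close>. Invariance gives \<open>2 embed b \<psi>\<^sub>0 = 0\<close> modulo \<open>I\<^sub>V\<close>, and \<open>2\<close> can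
  be cancelled.\<close>

lemma sign_change_fixed:
  assumes two: "(2::'k) \<noteq> 0" and x: "x \<in> free_carrier Gens" and fixed: "sign_change x - x \<in> V.I"
  obtains a where "a \<in> free_carrier Gens" "x - embed a \<in> V.I"
proof -
  obtain a b where ab: "a \<in> free_carrier Gens" "b \<in> free_carrier Gens"
      "x - (embed a + embed b * \<psi> 0) \<in> V.I" (is "?d \<in> _")
    using embed_decomposition[OF x] by blast
  have "sign_change ?d = sign_change x - embed a + embed b * \<psi> 0"
    by (simp add: sign_change_simps sign_change_embed sign_change_var sign_gen_def)
  then have "embed b * \<psi> 0 + embed b * \<psi> 0 = sign_change ?d - (sign_change x - x) - ?d"
    by (simp add: algebra_simps)
  also have "\<dots> \<in> V.I"
    by (intro V.I_diff sign_change_V_I fixed ab(3))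
  finally have "Poly_Mapping.single 0 (inverse 2) * (embed b * \<psi> 0 + embed b * \<psi> 0) \<in> V.I"
    by (intro V.I_mult_left) auto
  also have "Poly_Mapping.single 0 (inverse 2) * (embed b * \<psi> 0 + embed b * \<psi> 0) =
      (Poly_Mapping.single 0 (inverse 2) + Poly_Mapping.single 0 (inverse 2)) * (embed b * \<psi> 0)"
    by (simp add: algebra_simps)
  also have "Poly_Mapping.single 0 (inverse 2) + Poly_Mapping.single 0 (inverse 2) = (1 :: 'k gen_poly)"
  proof -
    have "inverse 2 + inverse 2 = (1::'k)"
      using two by (simp flip: mult_2)
    then show ?thesis
      by (simp only: single_one flip: single_add)
  qed
  finally have "?d + embed b * \<psi> 0 \<in> V.I"
    by (intro V.I_add ab(3)) simp
  then show thesis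
    using that[OF ab(1)] by simp
qed

section \<open>The isomorphism onto the fixed subalgebra\<close>

sublocale rho: presentation_hom "gens n \<beta>" "V_rel q n \<beta> \<union> cyclotomic_rel m \<beta>"
    "gens n \<beta>" "V_rel q n \<beta> \<union> cyclotomic_rel m \<beta>" sign_change
  by unfold_locales
    (simp_all add: sign_change_simps sign_change_carrier sign_change_V_I)

sublocale emb: presentation_hom "gens n \<beta>" "W_rel q n \<beta> \<union> cyclotomic_rel m \<beta>"
    "gens n \<beta>" "V_rel q n \<beta> \<union> cyclotomic_rel m \<beta>" embed
  by unfold_locales
    (simp_all add: embed_simps embed_carrier embed_W_I)

lemma rho_involution: "X \<in> carrier V.A \<Longrightarrow> rho.induced (rho.induced X) = X"
  by (auto simp: V.carrier_A rho.induced_cls)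

lemma is_rho_tilde_sign_change: "is_rho_tilde q n \<beta> m rho.induced"
proof -
  have maps: "rho.induced X \<in> carrier V.A" if "X \<in> carrier V.A" for X
    using that by (auto simp: V.carrier_A rho.induced_cls sign_change_carrier)
  have bij: "bij_betw rho.induced (carrier V.A) (carrier V.A)"
    by (rule bij_betwI[where g = rho.induced]) (auto simp: maps rho_involution)
  have iso: "rho.induced \<in> algebra_iso V.A V.A"
    unfolding algebra_iso_def ring_iso_def
    using rho.induced_ring_hom rho.induced_smult bij by auto
  have fix_gen: "rho.induced (V.cls (var g)) = V.cls (var g)" if "g \<noteq> Psi 0" for g
    using that by (simp add: rho.induced_cls sign_change_var sign_gen_def)
  have "rho.induced (V.cls (\<psi> 0)) = \<ominus>\<^bsub>V.A\<^esub> V.cls (\<psi> 0)"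
    by (simp add: rho.induced_cls sign_change_var sign_gen_def V.A_uminus psi0_carrier)
  then show ?thesis
    using iso rho_involution fix_gen
    unfolding is_rho_tilde_def V_cyc_def V_cyc_gen_def V.presented_gen_eq_cls by simp
qed

lemma embed_iso:
  assumes "(2::'k) \<noteq> 0"
  shows "emb.induced \<in> algebra_iso W.A (fixed_subalgebra V.A rho.induced)"
proof -
  let ?B = "fixed_subalgebra V.A rho.induced"
  have carrier_B: "carrier ?B = {X \<in> carrier V.A. rho.induced X = X}"
    and ops: "mult ?B = mult V.A" "add ?B = add V.A" "one ?B = one V.A" "smult ?B = smult V.A"
    by (simp_all add: fixed_subalgebra_def)
  have maps: "emb.induced X \<in> carrier ?B" if "X \<in> carrier W.A" for X
    using that
    by (auto simp: carrier_B W.carrier_A emb.induced_cls rho.induced_cls sign_change_embed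
        intro!: V.cls_carrier embed_carrier)
  have "inj_on emb.induced (carrier W.A)"
  proof (rule inj_onI)
    fix X Y assume "X \<in> carrier W.A" "Y \<in> carrier W.A" and eq: "emb.induced X = emb.induced Y"
    then obtain x y where xy: "X = W.cls x" "Y = W.cls y"
      by (auto simp: W.carrier_A)
    with eq have "embed (x - y) \<in> V.I"
      by (simp add: emb.induced_cls V.cls_eq_iff embed_simps)
    then show "X = Y"
      by (simp add: xy embed_I_iff W.cls_eq_iff)
  qed
  moreover have "emb.induced ` carrier W.A = carrier ?B"
  proof
    show "emb.induced ` carrier W.A \<subseteq> carrier ?B"
      using maps by auto
    show "carrier ?B \<subseteq> emb.induced ` carrier W.A"
    proof
      fix X assume "X \<in> carrier ?B"
      then obtain x where x: "x \<in> free_carrier Gens" "X = V.cls x" "sign_change x - x \<in> V.I"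
        by (auto simp: carrier_B V.carrier_A rho.induced_cls V.cls_eq_iff)
      obtain a where a: "a \<in> free_carrier Gens" "x - embed a \<in> V.I"
        using sign_change_fixed[OF assms x(1,3)] by blast
      then have "X = emb.induced (W.cls a)"
        by (simp add: x(2) emb.induced_cls V.cls_eq_iff)
      then show "X \<in> emb.induced ` carrier W.A"
        using a(1) by blast
    qed
  qed
  ultimately have "bij_betw emb.induced (carrier W.A) (carrier ?B)"
    by (simp add: bij_betw_def)
  moreover have "emb.induced \<in> ring_hom W.A ?B"
    using emb.induced_ring_hom maps by (auto simp: ring_hom_def ops)
  ultimately show ?thesis
    using emb.induced_smult unfolding algebra_iso_def ring_iso_def by (auto simp: ops)
qed

end

section \<open>Orbits as stable sets of tuples\<close>

lemma two_neq_zero: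
  assumes "CHAR('k::field) \<noteq> 2"
  shows "(2::'k) \<noteq> 0"
proof
  assume "(2::'k) = 0"
  then have "of_nat 2 = (0::'k)" by simp
  then have "CHAR('k) dvd 2" by (simp only: of_nat_eq_0_iff_char_dvd)
  then have "CHAR('k) \<le> 2" "CHAR('k) \<noteq> 0" using dvd_imp_le[of "CHAR('k)" 2] by (auto intro!: gr0I)
  moreover have "CHAR('k) \<noteq> 1"
    using of_nat_CHAR[where 'a = 'k] by (metis of_nat_1 zero_neq_one)
  ultimately show False using assms by linarith
qed

lemma inverse_S_set:
  assumes "x \<in> S_set q ls"
  shows "inverse x \<in> S_set q ls"
proof -
  obtain a e t where a: "a < length ls" "e \<in> {-1, 1}" "x = (ls ! a) powi e * q powi (2 * t)"
    using assms by (auto simp: S_set_def I_set_def)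
  then have "inverse x = (ls ! a) powi (- e) * q powi (2 * (- t))" "- e \<in> {-1, 1}"
    by (auto simp: power_int_minus)
  then show ?thesis
    using a(1) unfolding S_set_def I_set_def by blast
qed

lemma WB_orbit_stable_tuples:
  assumes "n \<ge> 2" "\<beta> \<in> WB_orbits n (S_set q ls)" "\<forall>i\<in>S_set q ls. m (inverse i) = m i"
  shows "stable_tuples n \<beta> m"
proof
  obtain i0 where i0: "i0 \<in> {1..n} \<rightarrow>\<^sub>E S_set q ls" "\<beta> = WB_orbit n i0"
    using assms(2) by (auto simp: WB_orbits_def)
  have entries: "foldr r_act as i0 j \<in> S_set q ls" if "set as \<subseteq> {0..<n}" "j \<in> {1..n}" for as j
    using that
  proof (induction as arbitrary: j)
    case Nil
    then show ?case using i0(1) by auto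
  next
    case (Cons a as)
    then show ?case by (auto simp: r_act_def intro: inverse_S_set)
  qed
  show "m (inverse (i 1)) = m (i 1)" if "i \<in> \<beta>" for i
    using that entries[of _ 1] assms(1,3) by (auto simp: i0(2) WB_orbit_def)
  show "r_act a i \<in> \<beta>" if a: "a < n" and "i \<in> \<beta>" for a i
  proof -
    obtain as where "set as \<subseteq> {0..<n}" "i = foldr r_act as i0"
      using \<open>i \<in> \<beta>\<close> by (auto simp: i0(2) WB_orbit_def)
    then have "set (a # as) \<subseteq> {0..<n}" "r_act a i = foldr r_act (a # as) i0"
      using a by auto
    then show ?thesis
      unfolding i0(2) WB_orbit_def by blast
  qed
qed (rule assms(1))

theorem proposition5p6:
  fixes q :: "'k::field" and ls :: "'k list" and n :: nat
    and \<beta> :: "'k tuple set" and m :: "'k \<Rightarrow> nat"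
  assumes "CHAR('k) \<noteq> 2"
    and "q \<noteq> 0" and "q\<^sup>2 \<noteq> 1"
    and "\<forall>a<length ls. ls ! a \<noteq> 0"
    and "\<forall>a<length ls. \<forall>b<length ls. a \<noteq> b \<longrightarrow> I_set q (ls ! a) \<inter> I_set q (ls ! b) = {}"
    and "n \<ge> 2"
    and "\<beta> \<in> WB_orbits n (S_set q ls)"
    and "finite {i \<in> S_set q ls. m i \<noteq> 0}"
    and "\<forall>i \<in> S_set q ls. m (inverse i) = m i"
  shows "\<exists>\<rho>. is_rho_tilde q n \<beta> m \<rho> \<and>
    algebra_iso (W_cyc q n \<beta> m) (fixed_subalgebra (V_cyc q n \<beta> m) \<rho>) \<noteq> {}"
proof -
  interpret stable_tuples q n \<beta> m
    using assms by (intro WB_orbit_stable_tuples)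
  show ?thesis
    using is_rho_tilde_sign_change embed_iso[OF two_neq_zero[OF assms(1)]]
    unfolding W_cyc_def V_cyc_def by blast
qed

end
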